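(* Let $D\subset\mathbb{C}$ be a bounded domain that has a computable boundary connectivity function, and let $\phi$ be a computable conformal map of the open unit disk $\mathbb{D}$ onto $D$. Then the boundary extension of $\phi$, i.e. the continuous extension of $\phi$ to the closed unit disk $\overline{\mathbb{D}}$, is computable.
   Context: A domain is an open connected subset of $\mathbb{C}$. A conformal map of $\mathbb{D}$ onto $D$ is an injective analytic map from $\mathbb{D}$ onto $D$. $\mathbb{N}$ is the set of non-negative integers. An arc is a homeomorphic image of $[0,1]$. A boundary connectivity function for $D$ is a function $g:\mathbb{N}\to\mathbb{N}$ such that whenever $p,q$ are distinct points of $\partial D$ with $|p-q|\le 2^{-g(k)}$, $\partial D$ contains an arc from $p$ to $q$ whose diameter is smaller than $2^{-k}$. (If $D$ is bounded and has a boundary connectivity function, then $\partial D$ is locally connected, and by a known theorem of Pommerenke $\phi$ has a continuous extension to $\overline{\mathbb{D}}$.) A function $g:\mathbb{N}\to\mathbb{N}$ is computable if there is an algorithm that on input $k$ outputs $g(k)$. A rational rectangle is a rectangle whose vertices are rational points. A function $f$ with $\operatorname{dom}(f)\subseteq\mathbb{C}$ and values in $\mathbb{C}$ is computable if there is an algorithm $P$ such that: (Approximation) given an open rational rectangle as input, $P$ either does not halt or outputs an open rational rectangle; (Correctness) whenever $P$ halts on an open rational rectangle $R$, the output rectangle contains $f(z)$ for each $z\in R\cap\operatorname{dom}(f)$; (Convergence) whenever $U$ is a neighborhood of $z\in\operatorname{dom}(f)$ and $V$ is a neighborhood of $f(z)$, there is an open rational rectangle $R$ with $z\in R\subseteq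 U$ such that on input $R$, $P$ outputs a rational rectangle included in $V$. *)

theory Defs
  imports "HOL-Complex_Analysis.Complex_Analysis" "HOL-Library.Nat_Bijection"
begin

(* Algorithms are Kleene's mu-recursive programs acting on lists of natural numbers.
   None means that the computation does not halt (or that too few arguments are given;
   surplus arguments are ignored by Succ, so no separate arity discipline is needed). *)
datatype recprog =
    Zero
  | Succ
  | Proj nat
  | Comp recprog "recprog list"
  | PrimRec recprog recprog
  | Mu recprog

primrec run :: "recprog \<Rightarrow> nat list \<Rightarrow> nat option" where
  "run Zero = (\<lambda>xs. Some 0)"
| "run Succ = (\<lambda>xs. case xs of [] \<Rightarrow> None | x # _ \<Rightarrow> Some (Suc x))"
| "run (Proj i) = (\<lambda>xs. if i < length xs then Some (xs ! i) else None)"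
| "run (Comp f gs) = (\<lambda>xs. Option.bind (those (map (\<lambda>g. run g xs) gs)) (run f))"
| "run (PrimRec f g) = (\<lambda>xs. case xs of [] \<Rightarrow> None | n # ys \<Rightarrow>
     rec_nat (run f ys) (\<lambda>m r. Option.bind r (\<lambda>v. run g (m # v # ys))) n)"
| "run (Mu f) = (\<lambda>xs.
     if \<exists>n. run f (n # xs) = Some 0 \<and> (\<forall>m<n. \<exists>v. run f (m # xs) = Some (Suc v))
     then Some (LEAST n. run f (n # xs) = Some 0) else None)"

definition computable_nat :: "(nat \<Rightarrow> nat) \<Rightarrow> bool" where
  "computable_nat g \<longleftrightarrow> (\<exists>P. \<forall>k. run P [k] = Some (g k))"

(* A (non-degenerate, axis-parallel) rational rectangle is given by the coordinates (a, b, c, d)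
   of its sides: its vertices are a + ic, b + ic, a + id, b + id. *)
type_synonym rat_rect = "rat \<times> rat \<times> rat \<times> rat"

definition is_rect :: "rat_rect \<Rightarrow> bool" where
  "is_rect = (\<lambda>(a, b, c, d). a < b \<and> c < d)"

definition open_rect :: "rat_rect \<Rightarrow> complex set" where
  "open_rect = (\<lambda>(a, b, c, d).
     box (Complex (of_rat a) (of_rat c)) (Complex (of_rat b) (of_rat d)))"

(* Rationals are coded by their reduced fraction, so that every rational rectangle has
   exactly one code and an algorithm on codes is an algorithm on rectangles. *)
definition rat_code :: "rat \<Rightarrow> nat" where
  "rat_code q = (let (m, n) = quotient_of q in prod_encode (int_encode m, nat n))"

definition rect_code :: "rat_rect \<Rightarrow> nat" where
  "rect_code = (\<lambda>(a, b, c, d). prod_encode (rat_code a,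
     prod_encode (rat_code b, prod_encode (rat_code c, rat_code d))))"

lemma inj_rat_code: "inj rat_code"
proof (rule injI)
  fix p q assume eq: "rat_code p = rat_code q"
  obtain a b c d where ab: "quotient_of p = (a, b)" and cd: "quotient_of q = (c, d)"
    by fastforce
  have "b > 0" "d > 0" using ab cd quotient_of_denom_pos by blast+
  with eq ab cd have "quotient_of p = quotient_of q"
    by (auto simp: rat_code_def int_encode_eq)
  thus "p = q" by (metis quotient_of_inject)
qed

lemma inj_rect_code: "inj rect_code"
  by (rule injI) (auto simp: rect_code_def inj_eq[OF inj_rat_code])

(* The function with domain A that agrees with f there is computable;
   the values of f outside A play no role. The three conjuncts are
   Approximation, Correctness and Convergence. *)
definition computable_on :: "complex set \<Rightarrow> (complex \<Rightarrow> complex) \<Rightarrow> bool" where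
  "computable_on A f \<longleftrightarrow> (\<exists>P.
     (\<forall>R n. is_rect R \<and> run P [rect_code R] = Some n \<longrightarrow>
        (\<exists>R'. is_rect R' \<and> n = rect_code R')) \<and>
     (\<forall>R R'. is_rect R \<and> is_rect R' \<and> run P [rect_code R] = Some (rect_code R') \<longrightarrow>
        (\<forall>z \<in> open_rect R \<inter> A. f z \<in> open_rect R')) \<and>
     (\<forall>z\<in>A. \<forall>U V. open U \<and> z \<in> U \<and> open V \<and> f z \<in> V \<longrightarrow>
        (\<exists>R R'. is_rect R \<and> is_rect R' \<and> z \<in> open_rect R \<and> open_rect R \<subseteq> U \<and>
           run P [rect_code R] = Some (rect_code R') \<and> open_rect R' \<subseteq> V)))"

definition boundary_connectivity_function :: "complex set \<Rightarrow> (nat \<Rightarrow> nat) \<Rightarrow> bool" where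
  "boundary_connectivity_function D g \<longleftrightarrow>
     (\<forall>k. \<forall>p \<in> frontier D. \<forall>q \<in> frontier D. p \<noteq> q \<and> dist p q \<le> 1 / 2 ^ g k \<longrightarrow>
        (\<exists>\<gamma>. arc \<gamma> \<and> pathstart \<gamma> = p \<and> pathfinish \<gamma> = q \<and>
           path_image \<gamma> \<subseteq> frontier D \<and> diameter (path_image \<gamma>) < 1 / 2 ^ k))"

definition conformal_map_onto :: "(complex \<Rightarrow> complex) \<Rightarrow> complex set \<Rightarrow> bool" where
  "conformal_map_onto \<phi> D \<longleftrightarrow>
     \<phi> analytic_on ball 0 1 \<and> inj_on \<phi> (ball 0 1) \<and> \<phi> ` ball 0 1 = D"

(* Since the open disk is dense in the closed one, \<psi> is unique on the closed disk. *)
definition boundary_extension :: "(complex \<Rightarrow> complex) \<Rightarrow> (complex \<Rightarrow> complex) \<Rightarrow> bool" where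
  "boundary_extension \<phi> \<psi> \<longleftrightarrow>
     continuous_on (cball 0 1) \<psi> \<and> (\<forall>z \<in> ball 0 1. \<psi> z = \<phi> z)"

end

(* Modulus of continuity. For a point zeta of the unit circle, F(u) = phi(zeta * (1 - e^u) / (1 + e^u)) is
   conformal on the strip |Im u| < pi/2, and Re u -> -oo corresponds to zeta. Since |F'|^2 integrates to
   at most the area of D, every interval of length L contains an s such that |F'|^2 integrates to O(1/L)
   over the segment Re u = s. The image of this segment is then a crosscut of D of diameter
   O(1/sqrt L), whose end points are joined in the boundary of D by an arc of diameter at most 2^-k once
   O(1/sqrt L) <= 2^-g(k). By Janiszewski's theorem one side of the crosscut is contained in a small
   disc, and for large k it must be the side of zeta. As L is explicit in g(k), this gives a computable
   modulus of continuity near the circle; the Schwarz lemma handles the points away from it.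

   Algorithm. Simulating the given algorithm for phi step by step is avoided: an input rectangle R
   may diverge, and rectangles with prescribed denominators are dense, so the denominators of the
   coordinates of R are read as a guess (S, k, T). The algorithm runs phi on S, checks that S meets the
   disc, that S and R are 2^-m(k)-close, and that T contains the 2^-k-neighbourhood of the output, and
   then returns T; it diverges if a check fails. *)
theory Submission imports Defs begin

section \<open>Recursive functions and predicates\<close>

text \<open>The modulus must be computable in \<open>k\<close>, but its constants need not be
  computed from \<open>D\<close>: \<open>computable_nat\<close> asks only that some program exist,
  so numbers depending on \<open>D\<close> and \<open>\<phi>\<close> can be built into it. What must
  be explicit is the dependence on \<open>g\<close>; hence length and area with stated constants
  instead of a compactness proof of uniform continuity. Logarithmic coordinates at zeta turn the
  classical weight dr/r on circular arcs into plain length along the strip. A stretch of length L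
  reaches down to radius about e^-L, which is why the reciprocal of the radius is doubly exponential
  in \<open>g k + k\<close>. The same modulus also produces the continuous extension. It compares
  values on the closed disc with values on the open disc, so answers of the given algorithm are used
  only for rectangles that meet the open disc, where they carry information. Guessing is legitimate
  because Convergence asks for just one suitable rectangle in each neighbourhood, whereas
  Correctness concerns every halting run; this is what the checks are for.\<close>

definition rec_fun :: "nat \<Rightarrow> (nat list \<Rightarrow> nat) \<Rightarrow> bool" where
  "rec_fun n f \<longleftrightarrow> (\<exists>P. \<forall>xs. length xs = n \<longrightarrow> run P xs = Some (f xs))"

lemma rec_fun_cong:
  assumes "rec_fun n f" "\<And>xs. length xs = n \<Longrightarrow> f xs = g xs"
  shows "rec_fun n g"
  using assms unfolding rec_fun_def by metis

lemma rec_fun_nth: "i < n \<Longrightarrow> rec_fun n (\<lambda>xs. xs ! i)"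
  unfolding rec_fun_def by (rule exI[of _ "Proj i"]) simp

lemma rec_fun_Suc:
  assumes "rec_fun n f"
  shows "rec_fun n (\<lambda>xs. Suc (f xs))"
proof -
  obtain P where "\<And>xs. length xs = n \<Longrightarrow> run P xs = Some (f xs)"
    using assms unfolding rec_fun_def by blast
  then show ?thesis
    unfolding rec_fun_def by (intro exI[of _ "Comp Succ [P]"]) simp
qed

lemma rec_fun_const: "rec_fun n (\<lambda>_. c)"
proof (induction c)
  case 0
  show ?case unfolding rec_fun_def by (rule exI[of _ Zero]) simp
qed (rule rec_fun_Suc)

lemma rec_fun_comp1:
  assumes "rec_fun 1 (\<lambda>xs. f (xs ! 0))" "rec_fun n g"
  shows "rec_fun n (\<lambda>xs. f (g xs))"
proof -
  obtain P Q where "\<And>xs. length xs = 1 \<Longrightarrow> run P xs = Some (f (xs ! 0))"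
    and "\<And>xs. length xs = n \<Longrightarrow> run Q xs = Some (g xs)"
    using assms unfolding rec_fun_def by blast
  then show ?thesis
    unfolding rec_fun_def by (intro exI[of _ "Comp P [Q]"]) simp
qed

lemma rec_fun_comp2:
  assumes "rec_fun 2 (\<lambda>xs. f (xs ! 0) (xs ! 1))" "rec_fun n g" "rec_fun n h"
  shows "rec_fun n (\<lambda>xs. f (g xs) (h xs))"
proof -
  obtain P Q R where "\<And>xs. length xs = 2 \<Longrightarrow> run P xs = Some (f (xs ! 0) (xs ! 1))"
    and "\<And>xs. length xs = n \<Longrightarrow> run Q xs = Some (g xs)"
    and "\<And>xs. length xs = n \<Longrightarrow> run R xs = Some (h xs)"
    using assms unfolding rec_fun_def by blast
  then show ?thesis
    unfolding rec_fun_def by (intro exI[of _ "Comp P [Q, R]"]) simp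
qed

lemma rec_fun_rec_nat:
  assumes "rec_fun n f" "rec_fun (Suc (Suc n)) g"
  shows "rec_fun (Suc n) (\<lambda>xs. rec_nat (f (tl xs)) (\<lambda>m v. g (m # v # tl xs)) (hd xs))"
proof -
  obtain P Q where P: "\<And>xs. length xs = n \<Longrightarrow> run P xs = Some (f xs)"
    and Q: "\<And>xs. length xs = Suc (Suc n) \<Longrightarrow> run Q xs = Some (g xs)"
    using assms unfolding rec_fun_def by blast
  have "run (PrimRec P Q) (m # ys) = Some (rec_nat (f ys) (\<lambda>m v. g (m # v # ys)) m)"
    if "length ys = n" for m ys
    using that by (induction m) (simp_all add: P Q)
  then show ?thesis
    unfolding rec_fun_def by (metis length_Suc_conv list.sel(1,3))
qed

lemma rec_fun_Least:
  assumes "rec_fun (Suc n) f" and ex: "\<And>xs. length xs = n \<Longrightarrow> \<exists>i. f (i # xs) = 0"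
  shows "rec_fun n (\<lambda>xs. LEAST i. f (i # xs) = 0)"
proof -
  obtain P where P: "\<And>xs. length xs = Suc n \<Longrightarrow> run P xs = Some (f xs)"
    using assms(1) unfolding rec_fun_def by blast
  have "run (Mu P) xs = Some (LEAST i. f (i # xs) = 0)" if len: "length xs = n" for xs
  proof -
    have eq: "run P (i # xs) = Some (f (i # xs))" for i
      using P len by simp
    have "\<exists>k. f (k # xs) = 0 \<and> (\<forall>m<k. \<exists>v. f (m # xs) = Suc v)"
      using exists_least_iff[of "\<lambda>i. f (i # xs) = 0"] ex[OF len] by (metis not0_implies_Suc)
    then show ?thesis by (simp add: eq)
  qed
  then show ?thesis unfolding rec_fun_def by blast
qed

lemma rec_fun_primrec2:
  assumes "rec_fun 1 (\<lambda>xs. f (xs ! 0))" "rec_fun 3 (\<lambda>xs. g (xs ! 0) (xs ! 1) (xs ! 2))"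
    and "\<And>y. h 0 y = f y" "\<And>x y. h (Suc x) y = g x (h x y) y"
  shows "rec_fun 2 (\<lambda>xs. h (xs ! 0) (xs ! 1))"
proof -
  have "rec_nat (f y) (\<lambda>m v. g m v y) x = h x y" for x y
    by (induction x) (simp_all add: assms(3,4))
  moreover have "rec_fun (Suc 1) (\<lambda>xs. rec_nat (f (tl xs ! 0)) (\<lambda>m v. g m v (tl xs ! 0)) (hd xs))"
    using rec_fun_rec_nat[of 1 "\<lambda>xs. f (xs ! 0)" "\<lambda>xs. g (xs ! 0) (xs ! 1) (xs ! 2)"] assms(1,2)
    by (simp add: numeral_3_eq_3)
  ultimately show ?thesis
    by (auto simp: length_Suc_conv numeral_2_eq_2 elim!: rec_fun_cong)
qed

lemma rec_fun_add:
  assumes "rec_fun n f" "rec_fun n g"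
  shows "rec_fun n (\<lambda>xs. f xs + g xs)"
proof (rule rec_fun_comp2[OF _ assms])
  show "rec_fun 2 (\<lambda>xs. xs ! 0 + xs ! 1)"
    by (rule rec_fun_primrec2[of "\<lambda>y. y" "\<lambda>x v y. Suc v"]; (intro rec_fun_Suc rec_fun_nth)?; simp)
qed

lemma rec_fun_mult:
  assumes "rec_fun n f" "rec_fun n g"
  shows "rec_fun n (\<lambda>xs. f xs * g xs)"
proof (rule rec_fun_comp2[OF _ assms])
  show "rec_fun 2 (\<lambda>xs. xs ! 0 * xs ! 1)"
    by (rule rec_fun_primrec2[of "\<lambda>y. 0" "\<lambda>x v y. y + v"]; (intro rec_fun_add rec_fun_const rec_fun_nth)?; simp)
qed

lemma rec_fun_pred:
  assumes "rec_fun n f"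
  shows "rec_fun n (\<lambda>xs. f xs - 1)"
proof (rule rec_fun_comp2[of "\<lambda>x y. x - 1", OF _ assms assms])
  show "rec_fun 2 (\<lambda>xs. xs ! 0 - 1)"
    by (rule rec_fun_primrec2[of "\<lambda>y. 0" "\<lambda>x v y. x"]; (intro rec_fun_const rec_fun_nth)?; simp)
qed

lemma rec_fun_diff:
  assumes "rec_fun n f" "rec_fun n g"
  shows "rec_fun n (\<lambda>xs. f xs - g xs)"
proof (rule rec_fun_comp2[OF _ assms(2,1)])
  \<comment> \<open>\<open>PrimRec\<close> recurses on its first argument, so the number subtracted
    has to come first.\<close>
  show "rec_fun 2 (\<lambda>xs. xs ! 1 - xs ! 0)"
    by (rule rec_fun_primrec2[of "\<lambda>y. y" "\<lambda>x v y. v - 1"]; (intro rec_fun_pred rec_fun_nth)?; simp)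
qed

lemma rec_fun_power:
  assumes "rec_fun n f" "rec_fun n g"
  shows "rec_fun n (\<lambda>xs. f xs ^ g xs)"
proof (rule rec_fun_comp2[OF _ assms(2,1)])
  show "rec_fun 2 (\<lambda>xs. (xs ! 1) ^ (xs ! 0))"
    by (rule rec_fun_primrec2[of "\<lambda>y. 1" "\<lambda>x v y. y * v"]; (intro rec_fun_mult rec_fun_const rec_fun_nth)?; simp)
qed

lemma rec_fun_div:
  assumes "rec_fun n f" "rec_fun n g"
  shows "rec_fun n (\<lambda>xs. f xs div g xs)"
proof (rule rec_fun_comp2[OF _ assms])
  \<comment> \<open>On the list \<open>[i, x, y]\<close> the first factor vanishes iff x < (i + 1) *
    y. The second is the sign of y: for y = 0 it stops the search at i = 0, the value of
    \<open>x div 0\<close>.\<close>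
  let ?h = "\<lambda>xs. (Suc (xs ! 1) - Suc (xs ! 0) * xs ! 2) * (1 - (1 - xs ! 2))"
  have least: "(LEAST i. ?h (i # xs) = 0) = xs ! 0 div xs ! 1" for xs :: "nat list"
  proof (rule Least_equality)
    let ?x = "xs ! 0" and ?y = "xs ! 1"
    have "?x < Suc (?x div ?y) * ?y" if "?y > 0"
      using dividend_less_div_times[OF that, of ?x] by simp
    then show "?h ((?x div ?y) # xs) = 0" by (cases "?y = 0") auto
    show "?x div ?y \<le> i" if "?h (i # xs) = 0" for i
      using that by (cases "?y = 0") (auto simp: less_mult_imp_div_less less_Suc_eq_le[symmetric])
  qed
  have "rec_fun 2 (\<lambda>xs. LEAST i. ?h (i # xs) = 0)"
  proof (rule rec_fun_Least)
    show "rec_fun (Suc 2) ?h"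
      by (intro rec_fun_mult rec_fun_diff rec_fun_Suc rec_fun_nth rec_fun_const) auto
    show "\<exists>i. ?h (i # xs) = 0" for xs
      by (rule exI[of _ "xs ! 0"]) (cases "xs ! 1", auto)
  qed
  then show "rec_fun 2 (\<lambda>xs. xs ! 0 div xs ! 1)" by (simp only: least)
qed

lemma rec_fun_mod:
  assumes "rec_fun n f" "rec_fun n g"
  shows "rec_fun n (\<lambda>xs. f xs mod g xs)"
  unfolding modulo_nat_def by (intro rec_fun_diff rec_fun_mult rec_fun_div assms)

lemma rec_fun_triangle:
  assumes "rec_fun n f"
  shows "rec_fun n (\<lambda>xs. triangle (f xs))"
  unfolding triangle_def by (intro rec_fun_mult rec_fun_div rec_fun_Suc rec_fun_const assms)

text \<open>\<open>prod_encode\<close> runs through the pairs diagonal by diagonal; the codes of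
  pairs with sum \<open>w\<close> start at \<open>triangle w\<close> and stay below
  \<open>triangle (Suc w)\<close>. Decoding is therefore a search for the diagonal, after which both
  components follow by subtraction.\<close>

lemma Least_triangle: "(LEAST w. Suc x - triangle (Suc w) = 0) = fst (prod_decode x) + snd (prod_decode x)"
proof -
  obtain a b where x: "prod_decode x = (a, b)" by fastforce
  then have "x = triangle (a + b) + a"
    using prod_decode_inverse[of x] by (simp add: prod_encode_def)
  have mono: "triangle i \<le> triangle j" if "i \<le> j" for i j
    unfolding triangle_def using that by (intro div_le_mono mult_le_mono) auto
  have "(LEAST w. Suc x - triangle (Suc w) = 0) = a + b"
  proof (rule Least_equality)
    show "Suc x - triangle (Suc (a + b)) = 0"
      using \<open>x = triangle (a + b) + a\<close> by simp
    show "a + b \<le> i" if "Suc x - triangle (Suc i) = 0" for i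
    proof (rule ccontr)
      assume "\<not> a + b \<le> i"
      then have "triangle (Suc i) \<le> x"
        using mono[of "Suc i" "a + b"] \<open>x = triangle (a + b) + a\<close> by linarith
      with that show False by linarith
    qed
  qed
  then show ?thesis using x by simp
qed

lemma rec_fun_prod_decode_sum:
  assumes "rec_fun n f"
  shows "rec_fun n (\<lambda>xs. fst (prod_decode (f xs)) + snd (prod_decode (f xs)))"
proof (rule rec_fun_comp1[OF _ assms])
  let ?h = "\<lambda>xs. Suc (xs ! 1) - triangle (Suc (xs ! 0))"
  have "rec_fun 1 (\<lambda>xs. LEAST w. ?h (w # xs) = 0)"
  proof (rule rec_fun_Least)
    show "rec_fun (Suc 1) ?h"
      by (intro rec_fun_diff rec_fun_triangle rec_fun_Suc rec_fun_nth) auto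
    show "\<exists>w. ?h (w # xs) = 0" for xs
      by (rule exI[of _ "xs ! 0"]) simp
  qed
  then show "rec_fun 1 (\<lambda>xs. fst (prod_decode (xs ! 0)) + snd (prod_decode (xs ! 0)))"
    using Least_triangle by simp
qed

lemma rec_fun_fst_prod_decode:
  assumes "rec_fun n f"
  shows "rec_fun n (\<lambda>xs. fst (prod_decode (f xs)))"
proof -
  have "fst (prod_decode x) = x - triangle (fst (prod_decode x) + snd (prod_decode x))" for x
    using prod_decode_inverse[of x] by (simp add: prod_encode_def split: prod.splits)
  moreover have "rec_fun n (\<lambda>xs. f xs - triangle (fst (prod_decode (f xs)) + snd (prod_decode (f xs))))"
    by (intro rec_fun_diff rec_fun_triangle rec_fun_prod_decode_sum assms)
  ultimately show ?thesis by simp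
qed

lemma rec_fun_snd_prod_decode:
  assumes "rec_fun n f"
  shows "rec_fun n (\<lambda>xs. snd (prod_decode (f xs)))"
proof -
  have "rec_fun n (\<lambda>xs. (fst (prod_decode (f xs)) + snd (prod_decode (f xs))) - fst (prod_decode (f xs)))"
    by (intro rec_fun_diff rec_fun_fst_prod_decode rec_fun_prod_decode_sum assms)
  then show ?thesis by simp
qed

lemmas rec_fun_intros = rec_fun_const rec_fun_nth rec_fun_Suc rec_fun_add rec_fun_mult rec_fun_diff
  rec_fun_power rec_fun_div rec_fun_mod rec_fun_fst_prod_decode rec_fun_snd_prod_decode

text \<open>Truth is the value 0, so that conjunction is addition and a \<open>Mu\<close> search can
  halt exactly when the predicate holds.\<close>

definition rec_pred :: "nat \<Rightarrow> (nat list \<Rightarrow> bool) \<Rightarrow> bool" where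
  "rec_pred n P \<longleftrightarrow> (\<exists>f. rec_fun n f \<and> (\<forall>xs. f xs = 0 \<longleftrightarrow> P xs))"

lemma rec_pred_le: "rec_fun n f \<Longrightarrow> rec_fun n g \<Longrightarrow> rec_pred n (\<lambda>xs. f xs \<le> g xs)"
  unfolding rec_pred_def by (rule exI[of _ "\<lambda>xs. f xs - g xs"]) (simp add: rec_fun_diff)

lemma rec_pred_less: "rec_fun n f \<Longrightarrow> rec_fun n g \<Longrightarrow> rec_pred n (\<lambda>xs. f xs < g xs)"
  using rec_pred_le[OF rec_fun_Suc[of n f]] by (simp add: Suc_le_eq)

lemma rec_pred_conj:
  assumes "rec_pred n P" "rec_pred n Q"
  shows "rec_pred n (\<lambda>xs. P xs \<and> Q xs)"
proof -
  obtain f g where "rec_fun n f" "rec_fun n g"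
    and "\<And>xs. f xs = 0 \<longleftrightarrow> P xs" "\<And>xs. g xs = 0 \<longleftrightarrow> Q xs"
    using assms unfolding rec_pred_def by metis
  then show ?thesis
    unfolding rec_pred_def by (intro exI[of _ "\<lambda>xs. f xs + g xs"]) (simp add: rec_fun_add)
qed

lemma rec_pred_eq: "rec_fun n f \<Longrightarrow> rec_fun n g \<Longrightarrow> rec_pred n (\<lambda>xs. f xs = g xs)"
  using rec_pred_conj[OF rec_pred_le[of n f g] rec_pred_le[of n g f]] by (simp add: eq_iff)

text \<open>All partiality of the final algorithm arises here, from \<open>Q\<close> and from a
  failed test \<open>A\<close>.\<close>

lemma run_guarded:
  assumes "rec_pred 2 A" "rec_fun 1 s" "rec_fun 1 t"
  shows "\<exists>P. \<forall>x. run P [x] =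
    (case run Q [s [x]] of None \<Rightarrow> None | Some y \<Rightarrow> if A [x, y] then Some (t [x]) else None)"
proof -
  obtain f where f: "rec_fun 2 f" and A: "\<And>xs. f xs = 0 \<longleftrightarrow> A xs"
    using assms(1) unfolding rec_pred_def by blast
  obtain F S T where F: "\<And>xs. length xs = 2 \<Longrightarrow> run F xs = Some (f xs)"
    and S: "\<And>xs. length xs = 1 \<Longrightarrow> run S xs = Some (s xs)"
    and T: "\<And>xs. length xs = 1 \<Longrightarrow> run T xs = Some (t xs)"
    using f assms(2,3) unfolding rec_fun_def by metis
  \<comment> \<open>The body ignores the search variable \<open>Proj 0\<close>, so the search stops
    at once or never.\<close>
  define G where "G = Mu (Comp F [Proj 1, Proj 2])"
  have G: "run G [x, y] = (if A [x, y] then Some 0 else None)" for x y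
    by (auto simp: G_def F A[symmetric] Least_equality)
  \<comment> \<open>\<open>Comp\<close> demands the values of all its arguments, even of those
    projected away; \<open>G\<close> contributes only its possible divergence.\<close>
  define P where "P = Comp (Comp (Proj 1) [G, Comp T [Proj 0]]) [Proj 0, Comp Q [S]]"
  have "run P [x] = (case run Q [s [x]] of None \<Rightarrow> None | Some y \<Rightarrow>
      if A [x, y] then Some (t [x]) else None)" for x
    by (simp add: P_def S T G split: option.splits)
  then show ?thesis by blast
qed

section \<open>Rational arithmetic on codes\<close>

text \<open>On the code of a rational, the numerator is \<open>code_pos - code_neg\<close>, and at most one of the two
  is nonzero; \<open>code_excess r r'\<close> is the left-hand side of the cross-multiplied inequality \<open>r < r'\<close>.\<close>

definition code_den :: "nat \<Rightarrow> nat" where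
  "code_den r = snd (prod_decode r)"

definition code_pos :: "nat \<Rightarrow> nat" where
  "code_pos r = (fst (prod_decode r) div 2) * (1 - fst (prod_decode r) mod 2)"

definition code_neg :: "nat \<Rightarrow> nat" where
  "code_neg r = (Suc (fst (prod_decode r)) div 2) * (fst (prod_decode r) mod 2)"

definition code_excess :: "nat \<Rightarrow> nat \<Rightarrow> nat" where
  "code_excess r r' = code_pos r * code_den r' + code_neg r' * code_den r"

text \<open>The least \<open>n > 0\<close> such that the denominator divides \<open>n\<close> times the numerator, i.e. the
  denominator of the reduced fraction. The last factor makes the search terminate on junk codes.\<close>

definition code_red_den :: "nat \<Rightarrow> nat" where
  "code_red_den r = Suc (LEAST i. (code_pos r + code_neg r) * Suc i mod code_den r * code_den r = 0)"

lemma rec_fun_code_den: "rec_fun n f \<Longrightarrow> rec_fun n (\<lambda>xs. code_den (f xs))"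
  unfolding code_den_def by (rule rec_fun_intros)

lemma rec_fun_code_pos: "rec_fun n f \<Longrightarrow> rec_fun n (\<lambda>xs. code_pos (f xs))"
  unfolding code_pos_def by (intro rec_fun_intros)

lemma rec_fun_code_neg: "rec_fun n f \<Longrightarrow> rec_fun n (\<lambda>xs. code_neg (f xs))"
  unfolding code_neg_def by (intro rec_fun_intros)

lemma rec_fun_code_excess:
  "rec_fun n f \<Longrightarrow> rec_fun n g \<Longrightarrow> rec_fun n (\<lambda>xs. code_excess (f xs) (g xs))"
  unfolding code_excess_def by (intro rec_fun_intros rec_fun_code_den rec_fun_code_pos rec_fun_code_neg)

lemma rec_fun_code_red_den:
  assumes "rec_fun n f"
  shows "rec_fun n (\<lambda>xs. code_red_den (f xs))"
proof (rule rec_fun_comp1[OF _ assms])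
  let ?h = "\<lambda>xs. (code_pos (xs ! 1) + code_neg (xs ! 1)) * Suc (xs ! 0) mod code_den (xs ! 1)
    * code_den (xs ! 1)"
  have "rec_fun 1 (\<lambda>xs. LEAST i. ?h (i # xs) = 0)"
  proof (rule rec_fun_Least)
    show "rec_fun (Suc 1) ?h"
      by (intro rec_fun_mult rec_fun_add rec_fun_mod rec_fun_Suc rec_fun_code_den rec_fun_code_pos
          rec_fun_code_neg rec_fun_nth) auto
    show "\<exists>i. ?h (i # xs) = 0" for xs
      by (rule exI[of _ "code_den (xs ! 0) - 1"]) (cases "code_den (xs ! 0) > 0", simp_all)
  qed
  then show "rec_fun 1 (\<lambda>xs. code_red_den (xs ! 0))"
    unfolding code_red_den_def by (intro rec_fun_Suc) simp
qed

text \<open>\<open>int_decode\<close> sends 2 j to j and 2 j + 1 to -(j + 1), which is why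
  \<open>code_neg\<close> rounds up.\<close>

lemma int_code_pos_neg: "int (code_pos r) - int (code_neg r) = int_decode (fst (prod_decode r))"
proof -
  let ?e = "fst (prod_decode r)"
  show ?thesis
    by (cases "even ?e")
       (auto simp: code_pos_def code_neg_def int_decode_def sum_decode_def even_iff_mod_2_eq_zero
          odd_iff_mod_2_eq_one elim!: oddE)
qed

lemma code_pos_add_neg: "int (code_pos r + code_neg r) = \<bar>int_decode (fst (prod_decode r))\<bar>"
proof -
  let ?e = "fst (prod_decode r)"
  show ?thesis
    by (cases "even ?e")
       (auto simp: code_pos_def code_neg_def int_decode_def sum_decode_def even_iff_mod_2_eq_zero
          odd_iff_mod_2_eq_one elim!: oddE)
qed

lemma prod_decode_rat_code:
  "prod_decode (rat_code q) = (int_encode (fst (quotient_of q)), nat (snd (quotient_of q)))"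
  by (simp add: rat_code_def split: prod.splits)

lemma code_den_rat_code: "code_den (rat_code q) = nat (snd (quotient_of q))"
  by (simp add: code_den_def prod_decode_rat_code)

lemma code_den_pos: "code_den (rat_code q) > 0"
  using quotient_of_denom_pos'[of q] by (simp add: code_den_rat_code)

lemma of_rat_rat_code:
  "real_of_rat q = (real (code_pos (rat_code q)) - real (code_neg (rat_code q))) / real (code_den (rat_code q))"
proof -
  obtain m n where mn: "quotient_of q = (m, n)" by fastforce
  then have "n > 0" "q = of_int m / of_int n"
    by (auto simp: quotient_of_div dest: quotient_of_denom_pos)
  moreover have "int (code_pos (rat_code q)) - int (code_neg (rat_code q)) = m"
    using mn by (simp add: int_code_pos_neg prod_decode_rat_code)
  then have "real (code_pos (rat_code q)) - real (code_neg (rat_code q)) = real_of_int m"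
    by (metis of_int_diff of_int_of_nat_eq)
  ultimately show ?thesis
    using mn by (simp add: code_den_rat_code of_rat_divide)
qed

lemma of_rat_diff_rat_code:
  "real_of_rat p - real_of_rat q =
    (real (code_excess (rat_code p) (rat_code q)) - real (code_excess (rat_code q) (rat_code p)))
      / (real (code_den (rat_code p)) * real (code_den (rat_code q)))"
  using code_den_pos[of p] code_den_pos[of q]
  by (simp add: of_rat_rat_code[of p] of_rat_rat_code[of q] code_excess_def field_simps)

lemma of_rat_less_iff_code:
  "real_of_rat p < real_of_rat q \<longleftrightarrow>
    code_excess (rat_code p) (rat_code q) < code_excess (rat_code q) (rat_code p)"
proof -
  have "real_of_rat p < real_of_rat q \<longleftrightarrow> real_of_rat p - real_of_rat q < 0" by simp
  also have "\<dots> \<longleftrightarrow> code_excess (rat_code p) (rat_code q) < code_excess (rat_code q) (rat_code p)"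
    unfolding of_rat_diff_rat_code using code_den_pos[of p] code_den_pos[of q]
    by (simp add: divide_less_0_iff mult_less_0_iff)
  finally show ?thesis .
qed

lemma of_rat_add_le_iff_code:
  "real_of_rat p + 1 / 2 ^ k \<le> real_of_rat q \<longleftrightarrow>
    code_excess (rat_code p) (rat_code q) * 2 ^ k + code_den (rat_code p) * code_den (rat_code q)
      \<le> code_excess (rat_code q) (rat_code p) * 2 ^ k" (is "?L \<longleftrightarrow> ?X \<le> ?Y")
proof -
  have "?L \<longleftrightarrow> real_of_rat p - real_of_rat q \<le> - 1 / 2 ^ k" by auto
  also have "\<dots> \<longleftrightarrow> real ?X \<le> real ?Y"
    unfolding of_rat_diff_rat_code using code_den_pos[of p] code_den_pos[of q]
    by (simp add: field_simps)
  finally show ?thesis by (simp only: of_nat_le_iff)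
qed

lemma of_rat_le_add_iff_code:
  "real_of_rat p \<le> real_of_rat q + 1 / 2 ^ k \<longleftrightarrow>
    code_excess (rat_code p) (rat_code q) * 2 ^ k
      \<le> code_excess (rat_code q) (rat_code p) * 2 ^ k + code_den (rat_code p) * code_den (rat_code q)"
  (is "?L \<longleftrightarrow> ?X \<le> ?Y")
proof -
  have "?L \<longleftrightarrow> real_of_rat p - real_of_rat q \<le> 1 / 2 ^ k" by auto
  also have "\<dots> \<longleftrightarrow> real ?X \<le> real ?Y"
    unfolding of_rat_diff_rat_code using code_den_pos[of p] code_den_pos[of q]
    by (simp add: field_simps)
  finally show ?thesis by (simp only: of_nat_le_iff)
qed

lemma square_sum_less_1_iff_code:
  "(real_of_rat p)\<^sup>2 + (real_of_rat q)\<^sup>2 < 1 \<longleftrightarrow>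
    ((code_pos (rat_code p) + code_neg (rat_code p)) * code_den (rat_code q)) ^ 2 +
    ((code_pos (rat_code q) + code_neg (rat_code q)) * code_den (rat_code p)) ^ 2
      < (code_den (rat_code p) * code_den (rat_code q)) ^ 2" (is "_ \<longleftrightarrow> ?X < ?Y")
proof -
  \<comment> \<open>One of the two numbers is 0, so their difference and their sum agree up to sign;
    squaring the sum avoids truncated subtraction.\<close>
  have *: "(real (code_pos r) - real (code_neg r))\<^sup>2 = (real (code_pos r + code_neg r))\<^sup>2" for r
  proof -
    have "\<bar>int (code_pos r) - int (code_neg r)\<bar> = int (code_pos r + code_neg r)"
      by (simp only: int_code_pos_neg code_pos_add_neg)
    then have "\<bar>real (code_pos r) - real (code_neg r)\<bar> = real (code_pos r + code_neg r)"
      by (metis of_int_abs of_int_diff of_int_of_nat_eq)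
    then show ?thesis by (metis power2_abs)
  qed
  have "x\<^sup>2 / m\<^sup>2 + y\<^sup>2 / n\<^sup>2 < 1 \<longleftrightarrow> (x * n)\<^sup>2 + (y * m)\<^sup>2 < (m * n)\<^sup>2"
    if "m > 0" "n > 0" for x y m n :: real
    using that by (simp add: field_simps power_mult_distrib)
  note aux = this[of "real (code_den (rat_code p))" "real (code_den (rat_code q))"
      "real (code_pos (rat_code p) + code_neg (rat_code p))"
      "real (code_pos (rat_code q) + code_neg (rat_code q))"]
  have "(real_of_rat p)\<^sup>2 + (real_of_rat q)\<^sup>2 < 1 \<longleftrightarrow> real ?X < real ?Y"
    unfolding of_rat_rat_code[of p] of_rat_rat_code[of q] power_divide *
    using aux code_den_pos[of p] code_den_pos[of q] by simp
  then show ?thesis by (simp only: of_nat_less_iff)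
qed

text \<open>A common factor would let a smaller multiplier clear the denominator, so equality forces
  coprimality, and a coprime pair with positive denominator is the \<open>quotient_of\<close> its
  fraction. Denominator 0 is rejected because \<open>code_red_den\<close> is a successor.\<close>

lemma ex_rat_code_iff: "(\<exists>q. r = rat_code q) \<longleftrightarrow> code_red_den r = code_den r"
proof
  let ?p = "code_pos r + code_neg r" and ?n = "code_den r"
  assume "\<exists>q. r = rat_code q"
  then obtain q where q: "r = rat_code q" by blast
  have n: "?n > 0" using code_den_pos q by simp
  have "int ?p = \<bar>fst (quotient_of q)\<bar>"
    by (simp only: code_pos_add_neg q prod_decode_rat_code fst_conv int_encode_inverse)
  moreover have "int ?n = snd (quotient_of q)"
    using q n by (simp add: code_den_rat_code)
  moreover have "coprime (fst (quotient_of q)) (snd (quotient_of q))"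
    by (rule quotient_of_coprime) simp
  ultimately have "coprime (int ?p) (int ?n)" by simp
  then have cop: "coprime ?p ?n" by (simp only: coprime_int_iff)
  have "(LEAST i. ?p * Suc i mod ?n * ?n = 0) = ?n - 1"
  proof (rule Least_equality)
    show "?p * Suc (?n - 1) mod ?n * ?n = 0" using n by simp
    show "?n - 1 \<le> i" if "?p * Suc i mod ?n * ?n = 0" for i
    proof -
      have "?n dvd ?p * Suc i" using that n by (simp add: mod_eq_0_iff_dvd)
      then have "?n dvd Suc i" using cop by (simp add: coprime_commute coprime_dvd_mult_right_iff del: mult_Suc_right)
      then show ?thesis by (auto dest: dvd_imp_le)
    qed
  qed
  then show "code_red_den r = ?n" using n by (simp only: code_red_den_def)
next
  let ?p = "code_pos r + code_neg r" and ?n = "code_den r" and ?e = "fst (prod_decode r)"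
  assume red: "code_red_den r = ?n"
  then have n: "?n > 0" by (simp add: code_red_den_def)
  have "gcd ?p ?n = 1"
  proof (rule ccontr)
    assume "gcd ?p ?n \<noteq> 1"
    moreover have "gcd ?p ?n > 0" using n by simp
    ultimately have g: "gcd ?p ?n > 1" by linarith
    obtain j where j: "?n = gcd ?p ?n * j" by (meson dvdE gcd_dvd2)
    then have "j > 0" using n by (cases j) auto
    obtain l where l: "?p = gcd ?p ?n * l" by (meson dvdE gcd_dvd1)
    have "?p * j = ?n * l" using j l by (metis mult.assoc mult.commute)
    then have "?p * Suc (j - 1) mod ?n * ?n = 0" using \<open>j > 0\<close> by simp
    then have "(LEAST i. ?p * Suc i mod ?n * ?n = 0) \<le> j - 1" by (rule Least_le)
    then have "?n \<le> j" using red \<open>j > 0\<close> unfolding code_red_den_def by linarith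
    moreover have "j < ?n" using j g \<open>j > 0\<close>
      by (metis mult_less_cancel2 nat_mult_1)
    ultimately show False by simp
  qed
  then have "coprime (int ?p) (int ?n)" by (simp only: coprime_int_iff) (simp add: coprime_iff_gcd_eq_1)
  then have cop: "coprime (int_decode ?e) (int ?n)"
    unfolding code_pos_add_neg by simp
  have "quotient_of (Fract (int_decode ?e) (int ?n)) = (int_decode ?e, int ?n)"
    using cop n by (simp add: quotient_of_Fract normalize_stable)
  then have "r = rat_code (Fract (int_decode ?e) (int ?n))"
    by (simp add: rat_code_def code_den_def)
  then show "\<exists>q. r = rat_code q" by blast
qed

section \<open>Codes of rectangles\<close>

text \<open>Sides 0 to 3 are left, right, bottom and top. The nested pairing is inverted on all
  numbers, not only on codes of rectangles.\<close>

definition side_code :: "nat \<Rightarrow> nat \<Rightarrow> nat" where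
  "side_code i x = [fst (prod_decode x), fst (prod_decode (snd (prod_decode x))),
     fst (prod_decode (snd (prod_decode (snd (prod_decode x))))),
     snd (prod_decode (snd (prod_decode (snd (prod_decode x)))))] ! i"

lemma rec_fun_side_code:
  assumes "rec_fun n f" "i < 4"
  shows "rec_fun n (\<lambda>xs. side_code i (f xs))"
proof -
  consider "i = 0" | "i = 1" | "i = 2" | "i = 3" using assms(2) by linarith
  then show ?thesis
    by cases (simp_all add: side_code_def rec_fun_fst_prod_decode rec_fun_snd_prod_decode assms(1)
        numeral_2_eq_2 numeral_3_eq_3)
qed

lemma side_code_rect_code:
  "side_code 0 (rect_code (a, b, c, d)) = rat_code a" "side_code 1 (rect_code (a, b, c, d)) = rat_code b"
  "side_code 2 (rect_code (a, b, c, d)) = rat_code c" "side_code 3 (rect_code (a, b, c, d)) = rat_code d"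
  by (simp_all add: side_code_def rect_code_def numeral_2_eq_2 numeral_3_eq_3)

lemma prod_encode_side_code:
  "prod_encode (side_code 0 x, prod_encode (side_code 1 x, prod_encode (side_code 2 x, side_code 3 x))) = x"
  by (simp add: side_code_def numeral_2_eq_2 numeral_3_eq_3)

text \<open>A guess is an arbitrary number, and the given program promises nothing about inputs that
  code no rectangle; hence this decidable test.\<close>

definition valid_code :: "nat \<Rightarrow> bool" where
  "valid_code x \<longleftrightarrow>
     (code_red_den (side_code 0 x) = code_den (side_code 0 x) \<and>
      code_red_den (side_code 1 x) = code_den (side_code 1 x)) \<and>
     (code_red_den (side_code 2 x) = code_den (side_code 2 x) \<and>
      code_red_den (side_code 3 x) = code_den (side_code 3 x)) \<and>
     code_excess (side_code 0 x) (side_code 1 x) < code_excess (side_code 1 x) (side_code 0 x) \<and>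
     code_excess (side_code 2 x) (side_code 3 x) < code_excess (side_code 3 x) (side_code 2 x)"

lemma valid_code_iff: "valid_code x \<longleftrightarrow> (\<exists>R. is_rect R \<and> x = rect_code R)"
proof
  assume v: "valid_code x"
  then obtain a b c d where q: "side_code 0 x = rat_code a" "side_code 1 x = rat_code b"
    "side_code 2 x = rat_code c" "side_code 3 x = rat_code d"
    unfolding valid_code_def ex_rat_code_iff[symmetric] by blast
  then have "a < b" "c < d"
    using v by (simp_all add: valid_code_def of_rat_less_iff_code[symmetric] of_rat_less)
  moreover have "x = rect_code (a, b, c, d)"
    using prod_encode_side_code[of x] by (simp only: q rect_code_def prod.case)
  ultimately show "\<exists>R. is_rect R \<and> x = rect_code R"
    by (auto simp: is_rect_def)
next
  assume "\<exists>R. is_rect R \<and> x = rect_code R"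
  then obtain a b c d where x: "x = rect_code (a, b, c, d)" and less: "a < b" "c < d"
    by (auto simp: is_rect_def)
  have red: "code_red_den (rat_code q) = code_den (rat_code q)" for q
    using ex_rat_code_iff by blast
  show "valid_code x"
    unfolding x valid_code_def side_code_rect_code of_rat_less_iff_code[symmetric]
    using less by (simp add: red of_rat_less)
qed

text \<open>A code is read as the guess \<open>i\<close> through the quotient of two denominators: the denominators
  \<open>2 ^ j\<close> and \<open>2 ^ j * Suc w\<close> encode \<open>w\<close>, and every \<open>w\<close> is encoded arbitrarily close to any point.\<close>

definition guess :: "nat \<Rightarrow> nat \<Rightarrow> nat" where
  "guess i x = code_den (side_code i x) div code_den (side_code 0 x) - 1"

lemma rec_fun_guess: "rec_fun n f \<Longrightarrow> i < 4 \<Longrightarrow> rec_fun n (\<lambda>xs. guess i (f xs))"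
  unfolding guess_def by (intro rec_fun_intros rec_fun_code_den rec_fun_side_code) auto

text \<open>The fractions used are 2 / 2^j apart, whatever \<open>w\<close> is. All large
  \<open>j\<close> are covered, and not just one, because the four sides of a rectangle must share
  the same \<open>j\<close>.\<close>

lemma rat_dense_denominator:
  fixes x y :: real
  assumes "x < y"
  shows "\<exists>J. \<forall>j\<ge>J. \<exists>q. x < real_of_rat q \<and> real_of_rat q < y \<and> code_den (rat_code q) = 2 ^ j * Suc w"
proof -
  obtain J where J: "2 / (y - x) < 2 ^ J"
    using real_arch_pow[of 2 "2 / (y - x)"] by auto
  have "\<exists>q. x < real_of_rat q \<and> real_of_rat q < y \<and> code_den (rat_code q) = 2 ^ j * Suc w" if "j \<ge> J" for j
  proof -
    let ?n = "2 ^ j * Suc w"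
    have "(2::real) ^ J \<le> 2 ^ j" using that by (intro power_increasing) auto
    with J have "2 / (y - x) < 2 ^ j" by linarith
    then have "2 < (y - x) * 2 ^ j" using assms by (simp add: field_simps)
    then have big: "2 * real (Suc w) < (y - x) * real ?n"
      using mult_strict_right_mono[of 2 "(y - x) * 2 ^ j" "real (Suc w)"] by (simp add: algebra_simps)
    define i where "i = \<lfloor>(x * real ?n - 1) / (2 * real (Suc w))\<rfloor> + 1"
    \<comment> \<open>congruent to 1 modulo \<open>2 * Suc w\<close>, hence coprime to the denominator\<close>
    define m where "m = 2 * int (Suc w) * i + 1"
    have "(x * real ?n - 1) / (2 * real (Suc w)) < i" "i \<le> (x * real ?n - 1) / (2 * real (Suc w)) + 1"
      unfolding i_def by linarith+
    then have "x * real ?n - 1 < 2 * real (Suc w) * i" "2 * real (Suc w) * i \<le> x * real ?n - 1 + 2 * real (Suc w)"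
      by (simp_all add: field_simps del: of_nat_Suc)
    moreover have "real_of_int m = 2 * real (Suc w) * i + 1"
      unfolding m_def by simp
    ultimately have "x * real ?n < m" "m < y * real ?n"
      using big by (auto simp: algebra_simps)
    moreover have npos: "real ?n > 0" by (simp only: of_nat_0_less_iff) simp
    ultimately have bounds: "x < real_of_int m / real ?n" "real_of_int m / real ?n < y"
      using npos by (simp_all only: pos_less_divide_eq pos_divide_less_eq)
    have "coprime m (2 * int (Suc w))"
      unfolding m_def by (simp only: coprime_commute[of _ "2 * int (Suc w)"])
        (metis coprime_1_right coprime_add_one_right mult.commute coprime_mult_left_iff dvd_triv_left coprime_divisors dvd_refl)
    then have "coprime m (int ?n)"
      by (simp only: of_nat_mult of_nat_power coprime_mult_right_iff coprime_power_right_iff of_nat_numeral) simp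
    then have quot: "quotient_of (Fract m (int ?n)) = (m, int ?n)"
      using npos by (simp only: quotient_of_Fract normalize_stable of_nat_0_less_iff)
    have "real_of_rat (Fract m (int ?n)) = real_of_int m / real_of_int (int ?n)"
      using npos by (intro of_rat_rat) linarith
    then have "real_of_rat (Fract m (int ?n)) = real_of_int m / real ?n"
      by (simp only: of_int_of_nat_eq)
    moreover have "code_den (rat_code (Fract m (int ?n))) = ?n"
      by (simp only: code_den_rat_code quot snd_conv nat_int)
    ultimately show ?thesis using bounds by metis
  qed
  then show ?thesis by blast
qed

lemma ex_rect_with_guesses:
  assumes "\<epsilon> > 0"
  obtains a b c d where
    "Re z - \<epsilon> < real_of_rat a" "real_of_rat a < Re z" "Re z < real_of_rat b" "real_of_rat b < Re z + \<epsilon>"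
    "Im z - \<epsilon> < real_of_rat c" "real_of_rat c < Im z" "Im z < real_of_rat d" "real_of_rat d < Im z + \<epsilon>"
    "guess 1 (rect_code (a, b, c, d)) = u" "guess 2 (rect_code (a, b, c, d)) = v"
    "guess 3 (rect_code (a, b, c, d)) = w"
proof -
  obtain J1 where J1: "\<forall>j\<ge>J1. \<exists>q. Re z - \<epsilon> < real_of_rat q \<and> real_of_rat q < Re z \<and> code_den (rat_code q) = 2 ^ j * Suc 0"
    using rat_dense_denominator[of "Re z - \<epsilon>" "Re z" 0] assms by auto
  obtain J2 where J2: "\<forall>j\<ge>J2. \<exists>q. Re z < real_of_rat q \<and> real_of_rat q < Re z + \<epsilon> \<and> code_den (rat_code q) = 2 ^ j * Suc u"
    using rat_dense_denominator[of "Re z" "Re z + \<epsilon>" u] assms by auto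
  obtain J3 where J3: "\<forall>j\<ge>J3. \<exists>q. Im z - \<epsilon> < real_of_rat q \<and> real_of_rat q < Im z \<and> code_den (rat_code q) = 2 ^ j * Suc v"
    using rat_dense_denominator[of "Im z - \<epsilon>" "Im z" v] assms by auto
  obtain J4 where J4: "\<forall>j\<ge>J4. \<exists>q. Im z < real_of_rat q \<and> real_of_rat q < Im z + \<epsilon> \<and> code_den (rat_code q) = 2 ^ j * Suc w"
    using rat_dense_denominator[of "Im z" "Im z + \<epsilon>" w] assms by auto
  define j where "j = J1 + J2 + J3 + J4"
  have "j \<ge> J1" "j \<ge> J2" "j \<ge> J3" "j \<ge> J4" by (auto simp: j_def)
  then obtain a b c d where
    "Re z - \<epsilon> < real_of_rat a" "real_of_rat a < Re z" "code_den (rat_code a) = 2 ^ j * Suc 0"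
    "Re z < real_of_rat b" "real_of_rat b < Re z + \<epsilon>" "code_den (rat_code b) = 2 ^ j * Suc u"
    "Im z - \<epsilon> < real_of_rat c" "real_of_rat c < Im z" "code_den (rat_code c) = 2 ^ j * Suc v"
    "Im z < real_of_rat d" "real_of_rat d < Im z + \<epsilon>" "code_den (rat_code d) = 2 ^ j * Suc w"
    using J1 J2 J3 J4 by meson
  then show ?thesis
    by (intro that[of a b c d]) (simp_all only: guess_def side_code_rect_code, simp_all del: mult_Suc_right)
qed

section \<open>The acceptance test\<close>

definition codes_within :: "nat \<Rightarrow> nat \<Rightarrow> nat \<Rightarrow> bool" where
  "codes_within k p q \<longleftrightarrow>
     code_excess p q * 2 ^ k \<le> code_excess q p * 2 ^ k + code_den p * code_den q"

definition codes_apart :: "nat \<Rightarrow> nat \<Rightarrow> nat \<Rightarrow> bool" where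
  "codes_apart k p q \<longleftrightarrow>
     code_excess p q * 2 ^ k + code_den p * code_den q \<le> code_excess q p * 2 ^ k"

definition code_corner :: "nat \<Rightarrow> nat \<Rightarrow> bool" where
  "code_corner p q \<longleftrightarrow> ((code_pos p + code_neg p) * code_den q) ^ 2 +
     ((code_pos q + code_neg q) * code_den p) ^ 2 < (code_den p * code_den q) ^ 2"

text \<open>\<open>x\<close> is the code of the input rectangle and \<open>y\<close> the output of the given algorithm on the guessed
  rectangle \<open>s\<close>. The lower left corner of \<open>s\<close> in the open disc ensures that \<open>s\<close> meets the disc.\<close>

definition accepts :: "(nat \<Rightarrow> nat) \<Rightarrow> nat \<Rightarrow> nat \<Rightarrow> bool" where
  "accepts m x y \<longleftrightarrow>
     (let s = guess 1 x; k = guess 2 x; t = guess 3 x in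
       (valid_code s \<and> valid_code t \<and> code_corner (side_code 0 s) (side_code 2 s)) \<and>
       (codes_within (Suc (m k)) (side_code 1 x) (side_code 0 s) \<and>
        codes_within (Suc (m k)) (side_code 1 s) (side_code 0 x) \<and>
        codes_within (Suc (m k)) (side_code 3 x) (side_code 2 s) \<and>
        codes_within (Suc (m k)) (side_code 3 s) (side_code 2 x)) \<and>
       codes_apart k (side_code 0 t) (side_code 0 y) \<and> codes_apart k (side_code 1 y) (side_code 1 t) \<and>
       codes_apart k (side_code 2 t) (side_code 2 y) \<and> codes_apart k (side_code 3 y) (side_code 3 t))"

lemma rec_pred_valid_code: "rec_fun n f \<Longrightarrow> rec_pred n (\<lambda>xs. valid_code (f xs))"
  unfolding valid_code_def
  by (intro rec_pred_conj rec_pred_eq rec_pred_less rec_fun_code_red_den rec_fun_code_den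
      rec_fun_code_excess rec_fun_side_code) simp_all

lemma rec_pred_code_corner: "rec_fun n f \<Longrightarrow> rec_fun n g \<Longrightarrow> rec_pred n (\<lambda>xs. code_corner (f xs) (g xs))"
  unfolding code_corner_def
  by (intro rec_pred_less rec_fun_add rec_fun_mult rec_fun_power rec_fun_const rec_fun_code_den
      rec_fun_code_pos rec_fun_code_neg)

lemma rec_pred_codes_within:
  "rec_fun n h \<Longrightarrow> rec_fun n f \<Longrightarrow> rec_fun n g \<Longrightarrow> rec_pred n (\<lambda>xs. codes_within (h xs) (f xs) (g xs))"
  unfolding codes_within_def
  by (intro rec_pred_le rec_fun_add rec_fun_mult rec_fun_power rec_fun_const rec_fun_code_den
      rec_fun_code_excess)

lemma rec_pred_codes_apart:
  "rec_fun n h \<Longrightarrow> rec_fun n f \<Longrightarrow> rec_fun n g \<Longrightarrow> rec_pred n (\<lambda>xs. codes_apart (h xs) (f xs) (g xs))"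
  unfolding codes_apart_def
  by (intro rec_pred_le rec_fun_add rec_fun_mult rec_fun_power rec_fun_const rec_fun_code_den
      rec_fun_code_excess)

lemma rec_fun_computable_nat: "computable_nat m \<Longrightarrow> rec_fun 1 (\<lambda>xs. m (xs ! 0))"
  unfolding computable_nat_def rec_fun_def by (metis One_nat_def length_0_conv length_Suc_conv nth_Cons_0)

lemma rec_pred_accepts:
  assumes "computable_nat m"
  shows "rec_pred 2 (\<lambda>xs. accepts m (xs ! 0) (xs ! 1))"
  unfolding accepts_def Let_def
  by (intro rec_pred_conj rec_pred_valid_code rec_pred_code_corner rec_pred_codes_within
      rec_pred_codes_apart rec_fun_guess rec_fun_side_code rec_fun_nth rec_fun_Suc
      rec_fun_comp1[of m, OF rec_fun_computable_nat[OF assms]]) simp_all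

section \<open>Computability from a computable modulus of continuity\<close>

lemma open_rect_iff:
  "z \<in> open_rect (a, b, c, d) \<longleftrightarrow> real_of_rat a < Re z \<and> Re z < real_of_rat b \<and>
     real_of_rat c < Im z \<and> Im z < real_of_rat d"
  by (auto simp: open_rect_def in_box_complex_iff)

text \<open>The test compares corners, which do not belong to the open rectangle; taking closures
  brings them in at the price of a closed ball.\<close>

lemma corners_near_of_open_rect_subset:
  assumes R: "is_rect (a, b, c, d)" "open_rect (a, b, c, d) \<subseteq> ball w r"
  shows "dist (Complex (of_rat a) (of_rat c)) w \<le> r" "dist (Complex (of_rat b) (of_rat d)) w \<le> r"
proof -
  have ne: "box (Complex (of_rat a) (of_rat c)) (Complex (of_rat b) (of_rat d)) \<noteq> {}"
    using R(1) by (auto simp: box_ne_empty Basis_complex_def is_rect_def of_rat_less)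
  have "cbox (Complex (of_rat a) (of_rat c)) (Complex (of_rat b) (of_rat d)) \<subseteq> cball w r"
    using R(2) closure_box[OF ne] closure_mono[of "open_rect (a, b, c, d)" "cball w r"] ball_subset_cball[of w r]
    by (fastforce simp: open_rect_def)
  moreover have "Complex (of_rat a) (of_rat c) \<in> cbox (Complex (of_rat a) (of_rat c)) (Complex (of_rat b) (of_rat d))"
    "Complex (of_rat b) (of_rat d) \<in> cbox (Complex (of_rat a) (of_rat c)) (Complex (of_rat b) (of_rat d))"
    using R(1) by (auto simp: in_cbox_complex_iff is_rect_def of_rat_less_eq)
  ultimately show "dist (Complex (of_rat a) (of_rat c)) w \<le> r" "dist (Complex (of_rat b) (of_rat d)) w \<le> r"
    by (auto simp: dist_commute)
qed

lemma dist_complex_le: "dist z w \<le> \<bar>Re z - Re w\<bar> + \<bar>Im z - Im w\<bar>"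
  by (metis cmod_le dist_norm minus_complex.sel(1,2))

lemma abs_Re_diff_le_dist: "\<bar>Re z - Re w\<bar> \<le> dist z w" and abs_Im_diff_le_dist: "\<bar>Im z - Im w\<bar> \<le> dist z w"
  by (metis abs_Re_le_cmod dist_norm minus_complex.sel(1), metis abs_Im_le_cmod dist_norm minus_complex.sel(2))

lemma accepts_rect_code_iff:
  assumes s: "guess 1 x = rect_code (sa, sb, sc, sd)" "is_rect (sa, sb, sc, sd)"
    and t: "guess 3 x = rect_code (ta, tb, tc, td)" "is_rect (ta, tb, tc, td)"
    and x: "x = rect_code (a, b, c, d)" and y: "y = rect_code (ya, yb, yc, yd)"
    and k: "guess 2 x = k"
  shows "accepts m x y \<longleftrightarrow>
    (real_of_rat sa)\<^sup>2 + (real_of_rat sc)\<^sup>2 < 1 \<and>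
    real_of_rat b \<le> real_of_rat sa + 1 / 2 ^ Suc (m k) \<and> real_of_rat sb \<le> real_of_rat a + 1 / 2 ^ Suc (m k) \<and>
    real_of_rat d \<le> real_of_rat sc + 1 / 2 ^ Suc (m k) \<and> real_of_rat sd \<le> real_of_rat c + 1 / 2 ^ Suc (m k) \<and>
    real_of_rat ta + 1 / 2 ^ k \<le> real_of_rat ya \<and> real_of_rat yb + 1 / 2 ^ k \<le> real_of_rat tb \<and>
    real_of_rat tc + 1 / 2 ^ k \<le> real_of_rat yc \<and> real_of_rat yd + 1 / 2 ^ k \<le> real_of_rat td"
proof -
  have "valid_code (guess 1 x)" "valid_code (guess 3 x)"
    unfolding valid_code_iff using s t by blast+
  moreover have "side_code i x = side_code i (rect_code (a, b, c, d))" for i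
    using x by simp
  ultimately show ?thesis
    unfolding accepts_def Let_def square_sum_less_1_iff_code of_rat_add_le_iff_code of_rat_le_add_iff_code
      k codes_within_def codes_apart_def code_corner_def s(1) t(1) y
    by (simp only: side_code_rect_code) blast
qed

lemma computable_on_cball_if_modulus:
  assumes comp: "computable_on (ball 0 1) \<phi>" and m: "computable_nat m"
    and modulus: "\<And>k z w. \<lbrakk>z \<in> cball 0 1; w \<in> ball 0 1; dist z w < 1 / 2 ^ m k\<rbrakk> \<Longrightarrow> dist (\<psi> z) (\<phi> w) \<le> 1 / 2 ^ k"
  shows "computable_on (cball 0 1) \<psi>"
proof -
  obtain Q where approx: "\<And>R n. is_rect R \<Longrightarrow> run Q [rect_code R] = Some n \<Longrightarrow> \<exists>R'. is_rect R' \<and> n = rect_code R'"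
    and correct: "\<And>R R' z. \<lbrakk>is_rect R; is_rect R'; run Q [rect_code R] = Some (rect_code R'); z \<in> open_rect R; z \<in> ball 0 1\<rbrakk>
       \<Longrightarrow> \<phi> z \<in> open_rect R'"
    and converge: "\<And>z U V. \<lbrakk>z \<in> ball 0 1; open U; z \<in> U; open V; \<phi> z \<in> V\<rbrakk> \<Longrightarrow>
        \<exists>R R'. is_rect R \<and> is_rect R' \<and> z \<in> open_rect R \<and> open_rect R \<subseteq> U \<and>
           run Q [rect_code R] = Some (rect_code R') \<and> open_rect R' \<subseteq> V"
    using comp unfolding computable_on_def by (elim exE conjE) (rule that; blast)
  have g: "rec_fun 1 (\<lambda>xs. guess 1 (xs ! 0))" "rec_fun 1 (\<lambda>xs. guess 3 (xs ! 0))"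
    by (rule rec_fun_guess[OF rec_fun_nth]; simp)+
  obtain P where P: "\<And>x. run P [x] = (case run Q [guess 1 x] of None \<Rightarrow> None
      | Some y \<Rightarrow> if accepts m x y then Some (guess 3 x) else None)"
    using run_guarded[OF rec_pred_accepts[OF m] g, of Q] unfolding nth_Cons_0 One_nat_def nth_Cons_Suc by blast
  have halt: "\<exists>y S T Y. run Q [guess 1 x] = Some y \<and> accepts m x y \<and> n = guess 3 x \<and>
      is_rect S \<and> guess 1 x = rect_code S \<and> is_rect T \<and> guess 3 x = rect_code T \<and>
      is_rect Y \<and> y = rect_code Y" if run: "run P [x] = Some n" for x n
  proof -
    obtain y where y: "run Q [guess 1 x] = Some y" "accepts m x y" "n = guess 3 x"
      using run P[of x] by (auto split: option.splits if_splits)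
    then have "valid_code (guess 1 x)" "valid_code (guess 3 x)" by (auto simp: accepts_def Let_def)
    then show ?thesis
      unfolding valid_code_iff using y approx by metis
  qed
  show ?thesis
    unfolding computable_on_def
  proof (intro exI[of _ P] conjI allI ballI impI)
    show "\<exists>R'. is_rect R' \<and> n = rect_code R'" if "is_rect R \<and> run P [rect_code R] = Some n" for R n
      using halt that by metis
  next
    fix R T z
    assume asm: "is_rect R \<and> is_rect T \<and> run P [rect_code R] = Some (rect_code T)"
      and z: "z \<in> open_rect R \<inter> cball 0 1"
    define x where "x = rect_code R"
    obtain y S Y where *: "run Q [guess 1 x] = Some y" "accepts m x y"
      "is_rect S" "guess 1 x = rect_code S" "guess 3 x = rect_code T" "is_rect Y" "y = rect_code Y"
      using halt[of x "rect_code T"] asm x_def by metis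
    obtain a b c d where R: "R = (a, b, c, d)" by (cases R)
    obtain sa sb sc sd where S: "S = (sa, sb, sc, sd)" by (cases S)
    obtain ta tb tc td where T: "T = (ta, tb, tc, td)" by (cases T)
    obtain ya yb yc yd where Y: "Y = (ya, yb, yc, yd)" by (cases Y)
    define k where "k = guess 2 x"
    note acc = accepts_rect_code_iff[of x sa sb sc sd ta tb tc td a b c d y ya yb yc yd k m, THEN iffD1]
    have acc: "(real_of_rat sa)\<^sup>2 + (real_of_rat sc)\<^sup>2 < 1"
      "real_of_rat b \<le> real_of_rat sa + 1 / 2 ^ Suc (m k)" "real_of_rat sb \<le> real_of_rat a + 1 / 2 ^ Suc (m k)"
      "real_of_rat d \<le> real_of_rat sc + 1 / 2 ^ Suc (m k)" "real_of_rat sd \<le> real_of_rat c + 1 / 2 ^ Suc (m k)"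
      "real_of_rat ta + 1 / 2 ^ k \<le> real_of_rat ya" "real_of_rat yb + 1 / 2 ^ k \<le> real_of_rat tb"
      "real_of_rat tc + 1 / 2 ^ k \<le> real_of_rat yc" "real_of_rat yd + 1 / 2 ^ k \<le> real_of_rat td"
      using acc * asm R S T Y x_def k_def by simp_all
    have "\<exists>w. w \<in> open_rect S \<inter> ball 0 1"
    proof -
      have less: "real_of_rat sa < of_rat sb" "real_of_rat sc < of_rat sd"
        using *(3) by (simp_all add: S is_rect_def of_rat_less)
      let ?p = "Complex (of_rat sa) (of_rat sc)"
      have "?p \<in> closure (open_rect S)"
        using less by (simp add: S open_rect_def closure_box box_ne_empty Basis_complex_def in_cbox_complex_iff less_imp_le)
      moreover have "?p \<in> ball 0 1"
        using acc(1) by (simp add: complex_norm)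
      ultimately show ?thesis
        using open_Int_closure_eq_empty[of "ball 0 1" "open_rect S"] by auto
    qed
    then obtain w where w: "w \<in> open_rect S" "w \<in> ball 0 1" by blast
    have zR: "real_of_rat a < Re z" "Re z < of_rat b" "real_of_rat c < Im z" "Im z < of_rat d"
      using z by (simp_all add: R open_rect_iff)
    have wS: "real_of_rat sa < Re w" "Re w < of_rat sb" "real_of_rat sc < Im w" "Im w < of_rat sd"
      using w by (simp_all add: S open_rect_iff)
    \<comment> \<open>The checks bound the coordinate differences for every pair of points of
      \<open>R\<close> and \<open>S\<close>, so any \<open>w\<close> will do.
      \<open>Suc (m k)\<close> leaves room for adding two coordinates.\<close>
    have "\<bar>Re z - Re w\<bar> < 1 / 2 ^ Suc (m k)" "\<bar>Im z - Im w\<bar> < 1 / 2 ^ Suc (m k)"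
      using zR wS acc by linarith+
    then have "dist z w < 1 / 2 ^ m k"
      using dist_complex_le[of z w] by simp
    then have near: "dist (\<psi> z) (\<phi> w) \<le> 1 / 2 ^ k"
      using modulus w z by blast
    have "\<phi> w \<in> open_rect Y"
      using correct[of S Y w] * asm w by auto
    then have "real_of_rat ya < Re (\<phi> w)" "Re (\<phi> w) < of_rat yb" "real_of_rat yc < Im (\<phi> w)" "Im (\<phi> w) < of_rat yd"
      by (simp_all add: Y open_rect_iff)
    then show "\<psi> z \<in> open_rect T"
      using acc near abs_Re_diff_le_dist[of "\<psi> z" "\<phi> w"] abs_Im_diff_le_dist[of "\<psi> z" "\<phi> w"]
      unfolding T open_rect_iff by linarith
  next
    fix z U V
    assume z: "z \<in> cball (0::complex) 1" and UV: "open U \<and> z \<in> U \<and> open V \<and> \<psi> z \<in> V"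
    obtain \<epsilon> where \<epsilon>: "\<epsilon> > 0" "ball (\<psi> z) \<epsilon> \<subseteq> V"
      using UV openE by blast
    obtain \<delta> where \<delta>: "\<delta> > 0" "ball z \<delta> \<subseteq> U"
      using UV openE by blast
    \<comment> \<open>A point of \<open>T\<close> will be within 4 * 2^-k of
      \<open>\<phi> w\<close>, and \<open>\<psi> z\<close> within 2^-k of it: five units in
      all.\<close>
    obtain k where "(1/2) ^ k < \<epsilon> / 5"
      using real_arch_pow_inv[of "\<epsilon> / 5" "1/2"] \<epsilon>(1) by auto
    then have k: "1 / 2 ^ k < \<epsilon> / 5" by (simp add: power_divide)
    \<comment> \<open>The checks tolerate 4 \<mu>. At most 3 \<mu> is spent: one each between a side
      of \<open>R\<close> and z, z and w, and w and a side of \<open>S\<close>.\<close>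
    define \<mu> :: real where "\<mu> = 1 / 2 ^ m k / 8"
    have \<mu>: "\<mu> > 0" "1 / 2 ^ Suc (m k) = 4 * \<mu>" "1 / 2 ^ m k = 8 * \<mu>" by (simp_all add: \<mu>_def)
    have "z \<in> closure (ball 0 1)" using z by simp
    then obtain w where w: "w \<in> ball 0 1" "dist w z < \<mu>"
      using \<mu>(1) closure_approachable by blast
    \<comment> \<open>The second bound keeps the lower left corner of \<open>S\<close> in the open
      disc, as the corner test demands.\<close>
    define \<eta> where "\<eta> = min \<mu> ((1 - norm w) / 2)"
    have \<eta>: "\<eta> > 0" "\<eta> \<le> \<mu>" "norm w + \<eta> < 1"
      using w \<mu>(1) by (auto simp: \<eta>_def min_def field_simps)
    obtain S Y where S: "is_rect S" "w \<in> open_rect S" "open_rect S \<subseteq> ball w \<eta>"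
      and Y: "is_rect Y" "run Q [rect_code S] = Some (rect_code Y)" "open_rect Y \<subseteq> ball (\<phi> w) (1 / 2 ^ k)"
      using converge[of w "ball w \<eta>" "ball (\<phi> w) (1 / 2 ^ k)"] w(1) \<eta>(1) by auto
    obtain sa sb sc sd where S': "S = (sa, sb, sc, sd)" by (cases S)
    obtain ya yb yc yd where Y': "Y = (ya, yb, yc, yd)" by (cases Y)
    define T where "T = (ya - 1 / 2 ^ k, yb + 1 / 2 ^ k, yc - 1 / 2 ^ k, yd + 1 / 2 ^ k)"
    have q: "real_of_rat (q - 1 / 2 ^ k) = of_rat q - 1 / 2 ^ k" "real_of_rat (q + 1 / 2 ^ k) = of_rat q + 1 / 2 ^ k" for q
      by (simp_all add: of_rat_diff of_rat_add of_rat_divide of_rat_power)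
    have "ya < yb" "yc < yd" using Y(1) by (simp_all add: Y' is_rect_def)
    moreover have "(0::rat) < 1 / 2 ^ k" by simp
    ultimately have T: "is_rect T"
      unfolding T_def is_rect_def prod.case by linarith
    define \<tau> where "\<tau> = min \<mu> (\<delta> / 2)"
    have \<tau>: "\<tau> > 0" "\<tau> \<le> \<mu>" "2 * \<tau> \<le> \<delta>" using \<mu> \<delta> by (auto simp: \<tau>_def)
    obtain a b c d where R:
      "Re z - \<tau> < real_of_rat a" "real_of_rat a < Re z" "Re z < real_of_rat b" "real_of_rat b < Re z + \<tau>"
      "Im z - \<tau> < real_of_rat c" "real_of_rat c < Im z" "Im z < real_of_rat d" "real_of_rat d < Im z + \<tau>"
      and g: "guess 1 (rect_code (a, b, c, d)) = rect_code S" "guess 2 (rect_code (a, b, c, d)) = k"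
      "guess 3 (rect_code (a, b, c, d)) = rect_code T"
      by (rule ex_rect_with_guesses[OF \<tau>(1), where z = z and u = "rect_code S" and v = k and w = "rect_code T"])
    have "is_rect (a, b, c, d)"
    proof -
      have "real_of_rat a < of_rat b" "real_of_rat c < of_rat d" using R by linarith+
      then show ?thesis by (simp add: is_rect_def of_rat_less)
    qed
    moreover have "z \<in> open_rect (a, b, c, d)" using R by (simp add: open_rect_iff)
    moreover have "open_rect (a, b, c, d) \<subseteq> U"
    proof
      fix p assume "p \<in> open_rect (a, b, c, d)"
      then have "\<bar>Re p - Re z\<bar> < \<tau>" "\<bar>Im p - Im z\<bar> < \<tau>" using R unfolding open_rect_iff by linarith+
      then have "dist p z < \<delta>" using dist_complex_le[of p z] \<tau> by linarith
      then show "p \<in> U" using \<delta> by (auto simp: dist_commute)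
    qed
    moreover have "open_rect T \<subseteq> V"
    proof
      fix p assume "p \<in> open_rect T"
      then have p: "of_rat ya - 1 / 2 ^ k < Re p" "Re p < of_rat yb + 1 / 2 ^ k"
        "of_rat yc - 1 / 2 ^ k < Im p" "Im p < of_rat yd + 1 / 2 ^ k"
        by (simp_all add: T_def open_rect_iff q)
      note corners = corners_near_of_open_rect_subset[OF Y(1,3)[unfolded Y']]
      have "\<bar>Re p - Re (\<phi> w)\<bar> \<le> 2 * (1 / 2 ^ k)" "\<bar>Im p - Im (\<phi> w)\<bar> \<le> 2 * (1 / 2 ^ k)"
        using p corners abs_Re_diff_le_dist[of "Complex (of_rat ya) (of_rat yc)" "\<phi> w"]
          abs_Im_diff_le_dist[of "Complex (of_rat ya) (of_rat yc)" "\<phi> w"]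
          abs_Re_diff_le_dist[of "Complex (of_rat yb) (of_rat yd)" "\<phi> w"]
          abs_Im_diff_le_dist[of "Complex (of_rat yb) (of_rat yd)" "\<phi> w"]
        unfolding complex.sel by linarith+
      then have "dist p (\<phi> w) \<le> 4 * (1 / 2 ^ k)" using dist_complex_le[of p "\<phi> w"] by linarith
      moreover have "dist (\<psi> z) (\<phi> w) \<le> 1 / 2 ^ k"
        using modulus[OF z w(1), of k] w(2) \<mu> by (simp add: dist_commute)
      ultimately have "dist (\<psi> z) p < \<epsilon>"
        using k dist_triangle[of "\<psi> z" p "\<phi> w"] by (simp add: dist_commute)
      then show "p \<in> V" using \<epsilon>(2) by auto
    qed
    moreover have "run P [rect_code (a, b, c, d)] = Some (rect_code T)"
    proof -
      note corners = corners_near_of_open_rect_subset[OF S(1,3)[unfolded S']]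
      have "accepts m (rect_code (a, b, c, d)) (rect_code Y)"
      proof (subst accepts_rect_code_iff)
        show "guess 1 (rect_code (a, b, c, d)) = rect_code (sa, sb, sc, sd)" "is_rect (sa, sb, sc, sd)"
          using g S S' by auto
        show "guess 3 (rect_code (a, b, c, d)) = rect_code (ya - 1 / 2 ^ k, yb + 1 / 2 ^ k, yc - 1 / 2 ^ k, yd + 1 / 2 ^ k)"
          "is_rect (ya - 1 / 2 ^ k, yb + 1 / 2 ^ k, yc - 1 / 2 ^ k, yd + 1 / 2 ^ k)"
          using g T by (simp_all add: T_def)
        show "rect_code (a, b, c, d) = rect_code (a, b, c, d)" "rect_code Y = rect_code (ya, yb, yc, yd)"
          "guess 2 (rect_code (a, b, c, d)) = k" using Y' g by auto
        have "norm (Complex (of_rat sa) (of_rat sc)) < 1"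
          using corners(1) \<eta>(3) norm_triangle_sub[of "Complex (of_rat sa) (of_rat sc)" w]
          by (simp add: dist_norm)
        then have "(real_of_rat sa)\<^sup>2 + (real_of_rat sc)\<^sup>2 < 1"
          by (simp add: complex_norm)
        moreover have "real_of_rat b \<le> real_of_rat sa + 4 * \<mu>" "real_of_rat sb \<le> real_of_rat a + 4 * \<mu>"
          "real_of_rat d \<le> real_of_rat sc + 4 * \<mu>" "real_of_rat sd \<le> real_of_rat c + 4 * \<mu>"
          using corners R \<tau> \<eta> w(2) abs_Re_diff_le_dist[of w z] abs_Im_diff_le_dist[of w z]
            abs_Re_diff_le_dist[of "Complex (of_rat sa) (of_rat sc)" w]
            abs_Im_diff_le_dist[of "Complex (of_rat sa) (of_rat sc)" w]
            abs_Re_diff_le_dist[of "Complex (of_rat sb) (of_rat sd)" w]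
            abs_Im_diff_le_dist[of "Complex (of_rat sb) (of_rat sd)" w]
          unfolding complex.sel by linarith+
        ultimately show "(real_of_rat sa)\<^sup>2 + (real_of_rat sc)\<^sup>2 < 1 \<and>
          real_of_rat b \<le> real_of_rat sa + 1 / 2 ^ Suc (m k) \<and> real_of_rat sb \<le> real_of_rat a + 1 / 2 ^ Suc (m k) \<and>
          real_of_rat d \<le> real_of_rat sc + 1 / 2 ^ Suc (m k) \<and> real_of_rat sd \<le> real_of_rat c + 1 / 2 ^ Suc (m k) \<and>
          real_of_rat (ya - 1 / 2 ^ k) + 1 / 2 ^ k \<le> real_of_rat ya \<and>
          real_of_rat yb + 1 / 2 ^ k \<le> real_of_rat (yb + 1 / 2 ^ k) \<and>
          real_of_rat (yc - 1 / 2 ^ k) + 1 / 2 ^ k \<le> real_of_rat yc \<and>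
          real_of_rat yd + 1 / 2 ^ k \<le> real_of_rat (yd + 1 / 2 ^ k)"
          unfolding \<mu>(2) q by simp
      qed
      then show ?thesis using P[of "rect_code (a, b, c, d)"] Y(2) g by simp
    qed
    ultimately show "\<exists>R R'. is_rect R \<and> is_rect R' \<and> z \<in> open_rect R \<and> open_rect R \<subseteq> U \<and>
           run P [rect_code R] = Some (rect_code R') \<and> open_rect R' \<subseteq> V"
      using T by blast
  qed
qed

section \<open>The length-area estimate\<close>

text \<open>The formula for the measure of an image under an injective differentiable map is used on
  \<open>real ^ 2\<close>, where the Jacobian is the determinant of a matrix.\<close>

definition complex_of_vec :: "real ^ 2 \<Rightarrow> complex" where
  "complex_of_vec v = Complex (v $ 1) (v $ 2)"

definition vec_of_complex :: "complex \<Rightarrow> real ^ 2" where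
  "vec_of_complex z = vector [Re z, Im z]"

lemma bounded_linear_complex_of_vec: "bounded_linear complex_of_vec"
  by (intro linear_linear[THEN iffD2] linearI) (auto simp: complex_of_vec_def complex_eq_iff)

lemma bounded_linear_vec_of_complex: "bounded_linear vec_of_complex"
  by (intro linear_linear[THEN iffD2] linearI) (auto simp: vec_of_complex_def vec_eq_iff forall_2)

lemma vec_of_complex_inverse: "complex_of_vec (vec_of_complex z) = z"
  by (simp add: complex_of_vec_def vec_of_complex_def)

lemma complex_of_vec_inverse: "vec_of_complex (complex_of_vec v) = v"
  by (simp add: complex_of_vec_def vec_of_complex_def vec_eq_iff forall_2)

lemma complex_of_vec_vector: "complex_of_vec (vector [x, y]) = Complex x y"
  by (simp add: complex_of_vec_def)

text \<open>Fubini is applied to pairs. The coordinate map \<open>g\<close> takes boxes to boxes of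
  equal content, so the integral is transferred with factor 1.\<close>

lemma integral_vec2_eq_iterated:
  fixes f :: "real ^ 2 \<Rightarrow> real"
  assumes f: "f integrable_on cbox (vector [a, c]) (vector [b, d])"
    and cont: "continuous_on (cbox (a, c) (b, d)) (\<lambda>p. f (vector [fst p, snd p]))"
  shows "integral (cbox (vector [a, c]) (vector [b, d])) f =
    integral {a..b} (\<lambda>x. integral {c..d} (\<lambda>y. f (vector [x, y])))"
proof -
  define g where "g = (\<lambda>p::real \<times> real. vector [fst p, snd p] :: real ^ 2)"
  define h where "h = (\<lambda>v::real ^ 2. (v $ 1, v $ 2))"
  have gh: "g (h v) = v" and hg: "h (g p) = p" for v p
    by (simp_all add: g_def h_def vec_eq_iff forall_2)
  have "bounded_linear g"
    by (intro linear_linear[THEN iffD2] linearI) (auto simp: g_def vec_eq_iff forall_2)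
  then have contg: "continuous (at x) g" for x
    by (simp add: linear_continuous_at)
  have gimg: "g ` cbox u v = cbox (g u) (g v)" for u v
  proof -
    have "g p \<in> cbox (g u) (g v) \<longleftrightarrow> p \<in> cbox u v" for p
      by (cases p; cases u; cases v) (auto simp: g_def mem_box_cart forall_2 cbox_Pair_eq)
    then show ?thesis using gh by (metis (no_types, lifting) image_eqI set_eqI imageE)
  qed
  then have himg: "h ` cbox u v = cbox (h u) (h v)" for u v
  proof -
    have "cbox u v = g ` cbox (h u) (h v)" by (simp add: gimg gh)
    then show ?thesis by (simp add: image_image hg)
  qed
  have "measure lborel (g ` cbox u v) = 1 * measure lborel (cbox u v)" for u v
  proof (cases "cbox u v = {}")
    case False
    then have "cbox (g u) (g v) \<noteq> {}" using gimg[of u v] by blast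
    moreover obtain u1 u2 v1 v2 where uv: "u = (u1, u2)" "v = (v1, v2)" by fastforce
    moreover have "u1 \<le> v1" "u2 \<le> v2" using False uv by (auto simp: cbox_Pair_eq)
    ultimately show ?thesis
      unfolding gimg uv by (simp add: content_cbox_cart content_Pair g_def prod_2 UNIV_2)
  qed simp
  then have "((\<lambda>p. f (g p)) has_integral (1 / 1) *\<^sub>R integral (cbox (vector [a, c]) (vector [b, d])) f)
      (h ` cbox (vector [a, c]) (vector [b, d]))"
    using gh hg contg gimg himg f
    by (intro has_integral_twiddle[where g = g and h = h]) (blast | simp add: integrable_integral)+
  moreover have "h ` cbox (vector [a, c]) (vector [b, d]) = cbox (a, c) (b, d)"
    unfolding himg by (simp add: h_def)
  ultimately have "integral (cbox (a, c) (b, d)) (\<lambda>p. f (g p)) = integral (cbox (vector [a, c]) (vector [b, d])) f"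
    by (simp add: integral_unique)
  moreover have "integral (cbox (a, c) (b, d)) (\<lambda>p. f (g p)) =
      integral (cbox a b) (\<lambda>x. integral (cbox c d) (\<lambda>y. f (g (x, y))))"
    by (rule integral_prod_continuous) (use cont in \<open>simp add: g_def\<close>)
  ultimately show ?thesis by (simp add: g_def cbox_interval)
qed

text \<open>The Jacobian of a holomorphic map is the square of the modulus of its derivative, so by
  injectivity the integral is the area of the image. The bound is the area of the square of side 2 B
  around the ball.\<close>

lemma area_integral_le:
  assumes F: "F holomorphic_on S" "open S" "inj_on F S"
    and rect: "\<And>x y. x \<in> {a..b} \<Longrightarrow> y \<in> {c..d} \<Longrightarrow> Complex x y \<in> S"
    and bnd: "F ` S \<subseteq> cball 0 B" and "B \<ge> 0"
  shows "integral {a..b} (\<lambda>x. integral {c..d} (\<lambda>y. (norm (deriv F (Complex x y)))\<^sup>2)) \<le> (2 * B)\<^sup>2"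
proof -
  define K :: "(real ^ 2) set" where "K = cbox (vector [a, c]) (vector [b, d])"
  define f where "f = (\<lambda>v. vec_of_complex (F (complex_of_vec v)))"
  define f' where "f' = (\<lambda>v h. vec_of_complex (deriv F (complex_of_vec v) * complex_of_vec h))"
  have K: "complex_of_vec v \<in> S" if "v \<in> K" for v
    using that rect unfolding K_def complex_of_vec_def by (auto simp: mem_box_cart forall_2)
  have der: "(f has_derivative f' v) (at v within K)" if "v \<in> K" for v
  proof -
    have "(F has_derivative (*) (deriv F (complex_of_vec v))) (at (complex_of_vec v))"
      using F K[OF that] holomorphic_derivI has_field_derivative_def by blast
    then have "(f has_derivative f' v) (at v)"
      unfolding f_def f'_def
      by (intro bounded_linear.has_derivative[OF bounded_linear_vec_of_complex]
          has_derivative_compose[OF bounded_linear_imp_has_derivative[OF bounded_linear_complex_of_vec]])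
    then show ?thesis by (rule has_derivative_at_withinI)
  qed
  have det: "\<bar>det (matrix (f' v))\<bar> = (norm (deriv F (complex_of_vec v)))\<^sup>2" for v
  proof -
    have "det (matrix (f' v)) = (norm (deriv F (complex_of_vec v)))\<^sup>2"
      unfolding cmod_power2
      by (simp add: det_2 matrix_def f'_def vec_of_complex_def complex_of_vec_def axis_def power2_eq_square)
    then show ?thesis by simp
  qed
  have inj: "inj_on f K"
  proof (rule inj_onI)
    fix v w assume vw: "v \<in> K" "w \<in> K" "f v = f w"
    then have "F (complex_of_vec v) = F (complex_of_vec w)"
      unfolding f_def by (metis vec_of_complex_inverse)
    then show "v = w" using F(3) K vw by (metis complex_of_vec_inverse inj_onD)
  qed
  have dF: "continuous_on S (deriv F)"
    using F holomorphic_deriv holomorphic_on_imp_continuous_on by blast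
  have "continuous_on K (\<lambda>v. deriv F (complex_of_vec v))"
    by (rule continuous_on_compose2[OF dF linear_continuous_on[OF bounded_linear_complex_of_vec]])
       (use K in blast)
  then have cont: "continuous_on K (\<lambda>v. (norm (deriv F (complex_of_vec v)))\<^sup>2)"
    by (intro continuous_intros)
  then have int: "(\<lambda>v. (norm (deriv F (complex_of_vec v)))\<^sup>2) integrable_on K"
    unfolding K_def by (rule integrable_continuous)
  let ?box = "cbox (vector [-B, -B]) (vector [B, B]) :: (real ^ 2) set"
  have "f ` K \<subseteq> ?box"
  proof
    fix w assume "w \<in> f ` K"
    then obtain v where v: "v \<in> K" "w = f v" by blast
    have "F (complex_of_vec v) \<in> cball 0 B" using bnd K v(1) by blast
    then have "norm (F (complex_of_vec v)) \<le> B" by simp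
    then show "w \<in> ?box"
      using abs_Re_le_cmod[of "F (complex_of_vec v)"] abs_Im_le_cmod[of "F (complex_of_vec v)"]
      by (auto simp: v(2) f_def vec_of_complex_def mem_box_cart forall_2)
  qed
  moreover have Kleb: "K \<in> sets lebesgue" by (simp add: K_def)
  moreover have "f ` K \<in> lmeasurable"
    using measurable_differentiable_image_eq[OF Kleb der inj] int det by simp
  ultimately have "measure lebesgue (f ` K) \<le> measure lebesgue ?box"
    by (intro measure_mono_fmeasurable) (auto simp: fmeasurableD)
  also have "measure lebesgue ?box = measure lborel ?box" by simp
  also have "\<dots> = (2 * B)\<^sup>2"
  proof -
    have "?box \<noteq> {}" using \<open>B \<ge> 0\<close> by (simp add: interval_ne_empty_cart forall_2)
    then show ?thesis by (simp add: content_cbox_cart prod_2 UNIV_2 power2_eq_square)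
  qed
  finally have "integral K (\<lambda>v. (norm (deriv F (complex_of_vec v)))\<^sup>2) \<le> (2 * B)\<^sup>2"
    using measure_differentiable_image_eq[OF Kleb der inj] int by (simp add: det)
  moreover have "continuous_on (cbox (a, c) (b, d)) (\<lambda>p. (norm (deriv F (complex_of_vec (vector [fst p, snd p]))))\<^sup>2)"
    unfolding complex_of_vec_vector
    by (intro continuous_intros continuous_on_compose2[OF dF] continuous_on_Complex)
       (use rect in \<open>auto simp: cbox_Pair_eq\<close>)
  ultimately show ?thesis
    using integral_vec2_eq_iterated[OF int[unfolded K_def]] by (simp add: K_def complex_of_vec_vector)
qed

section \<open>Small energy and small oscillation on a vertical segment\<close>

definition strip :: "real \<Rightarrow> complex set" where
  "strip h = {z. \<bar>Im z\<bar> < h}"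

lemma Complex_in_strip [simp]: "Complex x y \<in> strip h \<longleftrightarrow> \<bar>y\<bar> < h"
  by (simp add: strip_def)

lemma open_strip: "open (strip h)"
  unfolding strip_def by (intro open_Collect_less continuous_intros)

text \<open>For fixed \<open>r\<close> this is a mean value argument: more energy on every line
  would integrate to more than the area bound. Segments stop at r < h because nothing is known about
  \<open>F\<close> at the edges of the strip.\<close>

lemma ex_line_small_energy:
  assumes F: "F holomorphic_on strip h" "inj_on F (strip h)" and bnd: "F ` strip h \<subseteq> cball 0 B"
    and "B \<ge> 0" and "a < b"
  shows "\<exists>s\<in>{a..b}. \<forall>r<h. integral {-r..r} (\<lambda>y. (norm (deriv F (Complex s y)))\<^sup>2) \<le> (2 * B)\<^sup>2 / (b - a)"
proof -
  define E where "E = (2 * B)\<^sup>2 / (b - a)"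
  define G where "G = (\<lambda>x y. (norm (deriv F (Complex x y)))\<^sup>2)"
  have dF: "continuous_on (strip h) (deriv F)"
    using F open_strip holomorphic_deriv holomorphic_on_imp_continuous_on by blast
  have contG: "continuous_on (A \<times> {-r..r}) (\<lambda>(x, y). G x y)" if "r < h" for r A
    unfolding G_def case_prod_unfold
    by (intro continuous_intros continuous_on_compose2[OF dF] continuous_on_Complex) (use that in auto)
  define I where "I = (\<lambda>r x. integral {-r..r} (G x))"
  have contI: "continuous_on A (I r)" if "r < h" for r A
    unfolding I_def using integral_continuous_on_param[of A "-r" r G] contG[OF that]
    by (simp add: cbox_interval)
  have intG: "G x integrable_on {-r..r}" if "r < h" for x r
    unfolding G_def
    by (intro integrable_continuous_real continuous_intros continuous_on_compose2[OF dF] continuous_on_Complex)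
       (use that in auto)
  define K where "K = (\<lambda>r. {x \<in> {a..b}. I r x \<le> E})"
  have Kne: "K r \<noteq> {}" if rh: "r < h" for r
  proof
    assume "K r = {}"
    then have big: "E < I r x" if "x \<in> {a..b}" for x using that by (force simp: K_def)
    \<comment> \<open>Comparing with the minimum of \<open>I r\<close> turns the pointwise strict
      inequality into a strict one between integrals.\<close>
    obtain x0 where x0: "x0 \<in> {a..b}" "\<And>x. x \<in> {a..b} \<Longrightarrow> I r x0 \<le> I r x"
      using continuous_attains_inf[of "{a..b}" "I r"] contI[OF rh] \<open>a < b\<close> by auto
    have "(\<lambda>_. I r x0) integrable_on {a..b}" by (rule integrable_continuous_real) simp
    then have "(b - a) * I r x0 \<le> integral {a..b} (I r)"
      using integral_le[of "\<lambda>_. I r x0" "{a..b}" "I r"] x0 integrable_continuous_real[OF contI[OF rh]]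
        \<open>a < b\<close> by simp
    moreover have "integral {a..b} (I r) \<le> (2 * B)\<^sup>2"
      unfolding I_def G_def
      by (rule area_integral_le[OF F(1) open_strip F(2) _ bnd \<open>B \<ge> 0\<close>]) (use rh in auto)
    moreover have "(2 * B)\<^sup>2 < (b - a) * I r x0"
      using big[OF x0(1)] \<open>a < b\<close> by (simp add: E_def field_simps)
    ultimately show False by linarith
  qed
  have Kmono: "K r' \<subseteq> K r" if "r \<le> r'" "r' < h" for r r'
  proof
    fix x assume x: "x \<in> K r'"
    have "I r x \<le> I r' x"
      unfolding I_def
      by (rule integral_subset_le) (use that intG in \<open>auto simp: G_def\<close>)
    then show "x \<in> K r" using x by (simp add: K_def)
  qed
  have Kcomp: "compact (K r)" if "r < h" for r
  proof -
    have "closed (K r)"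
      unfolding K_def using continuous_closed_preimage[OF contI[OF that], of "{a..b}" "{..E}"]
      by (simp add: vimage_def Int_def)
    moreover have "{a..b} \<inter> K r = K r" by (auto simp: K_def)
    ultimately show ?thesis
      using compact_Int_closed[of "{a..b}" "K r"] by simp
  qed
  \<comment> \<open>The sets of good \<open>s\<close> shrink as \<open>r\<close> grows; by compactness one \<open>s\<close> is good for all \<open>r < h\<close>.\<close>
  define r where "r = (\<lambda>n::nat. h - 1 / Suc n)"
  have r: "r n < h" for n by (simp add: r_def)
  have "\<Inter> (range (\<lambda>n. K (r n))) \<noteq> {}"
  proof (rule compact_nest)
    show "K (r n) \<subseteq> K (r m)" if "m \<le> n" for m n
      by (rule Kmono[OF _ r]) (use that in \<open>simp add: r_def frac_le\<close>)
  qed (use Kcomp Kne r in auto)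
  then obtain s where s: "\<And>n. s \<in> K (r n)" by blast
  have "I q s \<le> E" if qh: "q < h" for q
  proof -
    obtain n where "1 / Suc n < h - q"
      using reals_Archimedean[of "h - q"] qh by (auto simp: inverse_eq_divide)
    then have "q \<le> r n" by (simp add: r_def)
    then show ?thesis using Kmono[OF _ r, of q n] s[of n] by (auto simp: K_def)
  qed
  moreover have "s \<in> {a..b}" using s by (auto simp: K_def)
  ultimately show ?thesis unfolding I_def G_def E_def by blast
qed

text \<open>The weight \<open>t\<close> stays free because it is chosen twice:
  \<open>\<delta> / (2 * h)\<close> balances the two terms and bounds the oscillation over the whole
  segment, while a large \<open>t\<close> makes the constant term small and gives uniform
  continuity.\<close>

lemma increment_le_energy:
  assumes F: "F holomorphic_on strip h"
    and energy: "\<And>r. r < h \<Longrightarrow> integral {-r..r} (\<lambda>y. (norm (deriv F (Complex s y)))\<^sup>2) \<le> E"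
    and y: "\<bar>y\<bar> < h" "\<bar>y'\<bar> < h" and "t > 0"
  shows "dist (F (Complex s y)) (F (Complex s y')) \<le> t * \<bar>y - y'\<bar> / 2 + E / (2 * t)"
proof -
  define g where "g = (\<lambda>y. deriv F (Complex s y))"
  have *: "dist (F (Complex s y)) (F (Complex s y')) \<le> t * \<bar>y - y'\<bar> / 2 + E / (2 * t)"
    if y: "\<bar>y\<bar> < h" "\<bar>y'\<bar> < h" and "y \<le> y'" for y y'
  proof -
    have dF: "continuous_on (strip h) (deriv F)"
      using F open_strip holomorphic_deriv holomorphic_on_imp_continuous_on by blast
    have contg: "continuous_on A g" if "A \<subseteq> {-h<..<h}" for A
      unfolding g_def
      by (intro continuous_intros continuous_on_compose2[OF dF] continuous_on_Complex)
        (use that in \<open>auto simp: subset_iff abs_less_iff\<close>)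
    define r where "r = max \<bar>y\<bar> \<bar>y'\<bar>"
    have r: "r < h" "{y..y'} \<subseteq> {-r..r}" "{-r..r} \<subseteq> {-h<..<h}" using y by (auto simp: r_def)
    have sub: "{y..y'} \<subseteq> {-h<..<h}" using r by blast
    have int: "(\<lambda>u. (norm (g u))\<^sup>2) integrable_on A" if "A = {-r..r} \<or> A = {y..y'}" for A
      using that r sub by (auto intro!: integrable_continuous_real continuous_intros contg)
    have der: "((\<lambda>u. F (Complex s u)) has_vector_derivative \<i> * g u) (at u within {y..y'})" if "u \<in> {y..y'}" for u
    proof -
      have "Complex s u \<in> strip h" using that y by auto
      then have "(F has_field_derivative g u) (at (Complex s u))"
        unfolding g_def using F open_strip holomorphic_derivI by blast
      moreover have "((\<lambda>u. Complex s u) has_vector_derivative \<i>) (at u within {y..y'})"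
        unfolding Complex_eq by (auto intro!: derivative_eq_intros)
      ultimately show ?thesis
        using field_vector_diff_chain_within[of "\<lambda>u. Complex s u" \<i> u "{y..y'}" F "g u"]
        by (simp add: o_def has_field_derivative_at_within)
    qed
    have "((\<lambda>u. \<i> * g u) has_integral F (Complex s y') - F (Complex s y)) {y..y'}"
      by (rule fundamental_theorem_of_calculus[OF \<open>y \<le> y'\<close> der])
    then have eq: "integral {y..y'} (\<lambda>u. \<i> * g u) = F (Complex s y') - F (Complex s y)"
      by (rule integral_unique)
    have "dist (F (Complex s y)) (F (Complex s y')) = norm (integral {y..y'} (\<lambda>u. \<i> * g u))"
      unfolding eq dist_norm by (rule norm_minus_commute)
    \<comment> \<open>AM-GM with weight \<open>t\<close>\<close>
    also have "\<dots> \<le> integral {y..y'} (\<lambda>u. t / 2 + (norm (g u))\<^sup>2 / (2 * t))"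
    proof (rule integral_norm_bound_integral)
      show "(\<lambda>u. \<i> * g u) integrable_on {y..y'}" "(\<lambda>u. t / 2 + (norm (g u))\<^sup>2 / (2 * t)) integrable_on {y..y'}"
        using sub \<open>t > 0\<close> by (intro integrable_continuous_real continuous_intros contg; simp)+
      show "norm (\<i> * g u) \<le> t / 2 + (norm (g u))\<^sup>2 / (2 * t)" for u
      proof -
        have "0 \<le> (norm (g u) - t)\<^sup>2 / (2 * t)" using \<open>t > 0\<close> by simp
        also have "\<dots> = t / 2 + (norm (g u))\<^sup>2 / (2 * t) - norm (g u)"
          using \<open>t > 0\<close> by (simp add: field_simps power2_eq_square)
        finally show ?thesis by (simp add: norm_mult)
      qed
    qed
    also have "\<dots> = integral {y..y'} (\<lambda>u. t / 2) + integral {y..y'} (\<lambda>u. (norm (g u))\<^sup>2 / (2 * t))"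
    proof (rule integral_add)
      show "(\<lambda>u. t / 2) integrable_on {y..y'}" by (rule integrable_continuous_real) simp
      show "(\<lambda>u. (norm (g u))\<^sup>2 / (2 * t)) integrable_on {y..y'}"
        using int by (intro integrable_on_divide) blast
    qed
    also have "\<dots> = t * \<bar>y - y'\<bar> / 2 + integral {y..y'} (\<lambda>u. (norm (g u))\<^sup>2) / (2 * t)"
      using \<open>y \<le> y'\<close> by (simp add: field_simps)
    also have "integral {y..y'} (\<lambda>u. (norm (g u))\<^sup>2) \<le> integral {-r..r} (\<lambda>u. (norm (g u))\<^sup>2)"
      by (rule integral_subset_le) (use r int in auto)
    also have "\<dots> \<le> E" using energy[OF r(1)] by (simp add: g_def)
    finally show ?thesis using \<open>t > 0\<close> by (simp add: divide_right_mono)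
  qed
  show ?thesis
    using *[of y y'] *[of y' y] y by (cases "y \<le> y'") (auto simp: dist_commute abs_minus_commute)
qed

lemma increment_le_uniform:
  assumes F: "F holomorphic_on strip h"
    and energy: "\<And>r. r < h \<Longrightarrow> integral {-r..r} (\<lambda>y. (norm (deriv F (Complex s y)))\<^sup>2) \<le> E"
    and y: "\<bar>y\<bar> < h" "\<bar>y'\<bar> < h" and "\<delta> > 0" and E: "2 * h * E \<le> \<delta>\<^sup>2"
  shows "dist (F (Complex s y)) (F (Complex s y')) \<le> \<delta>"
proof -
  have "h > 0" using y by linarith
  then have t: "\<delta> / (2 * h) > 0" using \<open>\<delta> > 0\<close> by simp
  have "dist (F (Complex s y)) (F (Complex s y')) \<le> \<delta> / (2 * h) * \<bar>y - y'\<bar> / 2 + E / (2 * (\<delta> / (2 * h)))"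
    by (rule increment_le_energy[OF F energy y t])
  also have "\<delta> / (2 * h) * \<bar>y - y'\<bar> / 2 \<le> \<delta> / (2 * h) * (2 * h) / 2"
    using y t by (intro divide_right_mono mult_left_mono) auto
  also have "E / (2 * (\<delta> / (2 * h))) \<le> \<delta> / 2"
    using E \<open>h > 0\<close> \<open>\<delta> > 0\<close> by (simp add: field_simps power2_eq_square)
  finally show ?thesis using \<open>h > 0\<close> by (simp add: field_simps)
qed

lemma uniformly_continuous_on_line:
  assumes F: "F holomorphic_on strip h"
    and energy: "\<And>r. r < h \<Longrightarrow> integral {-r..r} (\<lambda>y. (norm (deriv F (Complex s y)))\<^sup>2) \<le> E"
    and "E \<ge> 0"
  shows "uniformly_continuous_on {-h<..<h} (\<lambda>y. F (Complex s y))"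
  unfolding uniformly_continuous_on_def
proof (intro allI impI)
  fix e :: real assume "e > 0"
  \<comment> \<open>\<open>E + 1\<close> keeps t positive for E = 0 and makes the second term
    strictly less than e / 2.\<close>
  define t where "t = (E + 1) / e"
  have t: "t > 0" "E / (2 * t) < e / 2" using \<open>e > 0\<close> \<open>E \<ge> 0\<close> by (auto simp: t_def field_simps)
  show "\<exists>d>0. \<forall>y\<in>{-h<..<h}. \<forall>y'\<in>{-h<..<h}. dist y' y < d \<longrightarrow> dist (F (Complex s y')) (F (Complex s y)) < e"
  proof (intro exI[of _ "e / t"] conjI ballI impI)
    fix y y' assume y: "y \<in> {-h<..<h}" "y' \<in> {-h<..<h}" "dist y' y < e / t"
    then have "t * \<bar>y' - y\<bar> / 2 < e / 2" using t by (simp add: dist_real_def field_simps)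
    moreover have "dist (F (Complex s y')) (F (Complex s y)) \<le> t * \<bar>y' - y\<bar> / 2 + E / (2 * t)"
      by (rule increment_le_energy[OF F energy _ _ t(1)]) (use y in auto)
    ultimately show "dist (F (Complex s y')) (F (Complex s y)) < e" using t by linarith
  qed (use t \<open>e > 0\<close> in simp)
qed

section \<open>Crosscuts\<close>

text \<open>The end is a limit of image points. Were it \<open>F u\<close> itself, then, as
  \<open>F\<close> is open and injective, the points of the segment near its end would lie in a
  small ball around \<open>u\<close>; but that ball stays away from the edges of the strip.\<close>

lemma crosscut_end_in_frontier:
  assumes F: "F holomorphic_on strip h" "inj_on F (strip h)" and "h > 0"
    and G: "continuous_on {-h..h} G" "\<And>y. \<bar>y\<bar> < h \<Longrightarrow> G y = F (Complex s y)"
    and e: "\<bar>e\<bar> = h"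
  shows "G e \<in> frontier (F ` strip h)"
proof -
  have cl: "closure {-h<..<h} = {-h..h}" using \<open>h > 0\<close> by simp
  have "e \<in> {-h..h}" using e by auto
  have "G ` closure {-h<..<h} \<subseteq> closure (F ` strip h)"
  proof (rule image_closure_subset)
    show "continuous_on (closure {-h<..<h}) G" using G cl by simp
    show "G ` {-h<..<h} \<subseteq> closure (F ` strip h)"
      using G(2) closure_subset by (fastforce simp: abs_less_iff)
  qed simp
  then have "G e \<in> closure (F ` strip h)" using cl \<open>e \<in> {-h..h}\<close> by blast
  moreover have "G e \<notin> F ` strip h"
  proof
    assume "G e \<in> F ` strip h"
    then obtain u where u: "u \<in> strip h" "G e = F u" by blast
    define r where "r = (h - \<bar>Im u\<bar>) / 2"
    have r: "r > 0" "\<bar>Im u\<bar> + r < h" using u(1) by (auto simp: r_def strip_def field_simps)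
    have sub: "ball u r \<subseteq> strip h"
    proof
      fix v assume "v \<in> ball u r"
      then have "\<bar>Im v - Im u\<bar> < r"
        using abs_Im_le_cmod[of "v - u"] by (simp add: dist_norm norm_minus_commute)
      then show "v \<in> strip h" using r by (simp add: strip_def)
    qed
    have "open (F ` ball u r)"
      using F sub by (intro open_mapping_thm3) (auto intro: holomorphic_on_subset inj_on_subset)
    moreover have "G e \<in> F ` ball u r" using u r by simp
    ultimately obtain \<epsilon> where \<epsilon>: "\<epsilon> > 0" "ball (G e) \<epsilon> \<subseteq> F ` ball u r"
      using openE by blast
    then obtain d where d: "d > 0" "\<And>y. y \<in> {-h..h} \<Longrightarrow> dist y e < d \<Longrightarrow> dist (G y) (G e) < \<epsilon>"
      using G(1) \<open>e \<in> {-h..h}\<close> unfolding continuous_on_iff by metis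
    have "e \<in> closure {-h<..<h}" using cl \<open>e \<in> {-h..h}\<close> by simp
    moreover have "min d (h - \<bar>Im u\<bar> - r) > 0" using d(1) r by simp
    ultimately obtain y where y: "y \<in> {-h<..<h}" "dist y e < min d (h - \<bar>Im u\<bar> - r)"
      using closure_approachable by blast
    have "dist (G y) (G e) < \<epsilon>" by (rule d(2)) (use y in auto)
    then have "G y \<in> F ` ball u r" using \<epsilon>(2) by (auto simp: dist_commute)
    moreover have "G y = F (Complex s y)" using G(2) y by auto
    ultimately obtain v where v: "v \<in> ball u r" "F v = F (Complex s y)" by auto
    then have "v = Complex s y" using F(2) sub y by (auto dest!: inj_onD)
    moreover have "\<bar>Im v - Im u\<bar> < r"
      using v abs_Im_le_cmod[of "v - u"] by (simp add: dist_norm norm_minus_commute)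
    ultimately have "\<bar>y\<bar> < \<bar>Im u\<bar> + r" by simp
    moreover have "\<bar>y - e\<bar> < h - \<bar>Im u\<bar> - r" using y(2) by (simp add: dist_real_def)
    ultimately show False using e by linarith
  qed
  moreover have "open (F ` strip h)" using F open_strip open_mapping_thm3 by blast
  ultimately show ?thesis by (simp add: frontier_def interior_open)
qed

text \<open>Suppose points \<open>a\<close> and \<open>b\<close> on opposite sides both lie outside
  the disc. They can be joined off \<open>K\<close> through the complement of the disc, and off the
  boundary inside the image, hence off both at once; yet removing the line splits the strip. The
  hypothesis \<open>link\<close> includes p = q, when the crosscut closes up to a loop.\<close>

lemma crosscut_side_in_cball:
  assumes F: "F holomorphic_on strip h" "inj_on F (strip h)" and "h > 0"
    and uc: "uniformly_continuous_on {-h<..<h} (\<lambda>y. F (Complex s y))"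
    and osc: "\<And>y y'. \<bar>y\<bar> < h \<Longrightarrow> \<bar>y'\<bar> < h \<Longrightarrow> dist (F (Complex s y)) (F (Complex s y')) \<le> \<delta>"
    and "\<delta> \<le> \<rho>"
    and link: "\<And>p q. \<lbrakk>p \<in> frontier (F ` strip h); q \<in> frontier (F ` strip h); dist p q \<le> \<delta>\<rbrakk> \<Longrightarrow>
      \<exists>A. compact A \<and> connected A \<and> p \<in> A \<and> q \<in> A \<and> A \<subseteq> frontier (F ` strip h) \<and> A \<subseteq> cball p \<rho>"
  shows "\<exists>p. F ` {u \<in> strip h. Re u < s} \<subseteq> cball p \<rho> \<or> F ` {u \<in> strip h. s < Re u} \<subseteq> cball p \<rho>"
proof -
  define D where "D = F ` strip h"
  have cl: "closure {-h<..<h} = {-h..h}" using \<open>h > 0\<close> by simp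
  obtain G where "uniformly_continuous_on {-h..h} G" and "\<And>y. y \<in> {-h<..<h} \<Longrightarrow> F (Complex s y) = G y"
    using uniformly_continuous_on_extension_on_closure[OF uc] unfolding cl by metis
  then have G: "continuous_on {-h..h} G" "\<And>y. \<bar>y\<bar> < h \<Longrightarrow> G y = F (Complex s y)"
    by (auto simp: uniformly_continuous_imp_continuous abs_less_iff)
  define p where "p = G h"
  define q where "q = G (-h)"
  have pq: "p \<in> frontier D" "q \<in> frontier D"
    unfolding p_def q_def D_def using crosscut_end_in_frontier[OF F \<open>h > 0\<close> G] \<open>h > 0\<close> by auto
  have openD: "open D" unfolding D_def using F open_strip open_mapping_thm3 by blast
  \<comment> \<open>The oscillation is known only strictly inside the segment; it is extended to the
    ends one argument at a time, here and in \<open>near_p\<close>.\<close>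
  have near: "G y \<in> cball (F (Complex s y')) \<delta>" if "y \<in> {-h..h}" "\<bar>y'\<bar> < h" for y y'
  proof -
    have "G ` closure {-h<..<h} \<subseteq> cball (F (Complex s y')) \<delta>"
      by (rule image_closure_subset) (use G osc that cl in \<open>auto simp: abs_less_iff\<close>)
    then show ?thesis using that cl by blast
  qed
  have near_p: "G y \<in> cball p \<delta>" if "y \<in> {-h..h}" for y
  proof -
    have "G ` closure {-h<..<h} \<subseteq> cball p \<delta>"
      by (rule image_closure_subset)
         (use G near[of h] cl \<open>h > 0\<close> in \<open>auto simp: abs_less_iff p_def dist_commute\<close>)
    then show ?thesis using that cl by blast
  qed
  have "dist p q \<le> \<delta>" using near_p[of "-h"] \<open>h > 0\<close> by (simp add: q_def)
  then obtain A where A: "compact A" "connected A" "p \<in> A" "q \<in> A" "A \<subseteq> frontier D" "A \<subseteq> cball p \<rho>"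
    using link pq unfolding D_def by blast
  define K where "K = G ` {-h..h} \<union> A"
  have "compact K" unfolding K_def using A G by (intro compact_Un compact_continuous_image) auto
  have Ksub: "K \<subseteq> cball p \<rho>"
    using near_p A(6) \<open>\<delta> \<le> \<rho>\<close> unfolding K_def by fastforce
  have "K \<inter> frontier D = A"
  proof -
    have "G y \<in> A" if "y \<in> {-h..h}" "G y \<in> frontier D" for y
    proof (cases "\<bar>y\<bar> < h")
      case True
      then have "G y \<in> D" using G(2) by (simp add: D_def)
      then show ?thesis using that openD by (simp add: frontier_def interior_open)
    next
      case False
      then have "y = h \<or> y = -h" using that by auto
      then show ?thesis using A by (auto simp: p_def q_def)
    qed
    then show ?thesis using A unfolding K_def by blast
  qed
  define left where "left = F ` {u \<in> strip h. Re u < s}"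
  define right where "right = F ` {u \<in> strip h. s < Re u}"
  have op: "open left" "open right"
    unfolding left_def right_def
    by (intro open_mapping_thm3 holomorphic_on_subset[OF F(1)] inj_on_subset[OF F(2)] open_Collect_conj;
        auto simp: open_halfspace_Re_lt open_halfspace_Re_gt intro: open_strip[unfolded strip_def] simp: strip_def)+
  have disj: "left \<inter> right = {}"
    unfolding left_def right_def using F(2) by (force dest: inj_onD)
  have False if a: "a \<in> left" "a \<notin> cball p \<rho>" and b: "b \<in> right" "b \<notin> cball p \<rho>" for a b
  proof -
    have "connected D"
    proof -
      have "strip h = {z. Im z < h} \<inter> {z. Im z > -h}" by (auto simp: strip_def)
      then have "convex (strip h)"
        by (simp add: convex_Int convex_halfspace_Im_lt convex_halfspace_Im_gt)
      then show ?thesis unfolding D_def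
        using F holomorphic_on_imp_continuous_on convex_connected connected_continuous_image by blast
    qed
    moreover have "a \<in> D" "b \<in> D" using a b by (auto simp: left_def right_def D_def)
    moreover have "D \<subseteq> - frontier D" using openD by (auto simp: frontier_def interior_open)
    ultimately have "connected_component (- frontier D) a b"
      by (auto simp: connected_component_def)
    moreover have "connected_component (- K) a b"
    proof -
      have "connected (- cball p \<rho>)" by (intro connected_complement_bounded_convex) auto
      then show ?thesis unfolding connected_component_def
        using a b Ksub by (intro exI[of _ "- cball p \<rho>"]) auto
    qed
    \<comment> \<open>Neither \<open>K\<close> nor the boundary separates \<open>a\<close> from \<open>b\<close>, and their intersection is connected.\<close>
    ultimately have "connected_component (- (K \<union> frontier D)) a b"
      using \<open>compact K\<close> \<open>K \<inter> frontier D = A\<close> A by (intro Janiszewski) auto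
    then obtain W where W: "connected W" "W \<subseteq> - (K \<union> frontier D)" "a \<in> W" "b \<in> W"
      by (auto simp: connected_component_def)
    have "W \<subseteq> D"
      using connected_Int_frontier[OF W(1), of D] W \<open>a \<in> D\<close> by blast
    have "W \<subseteq> left \<union> right"
    proof
      fix w assume w: "w \<in> W"
      then obtain u where u: "u \<in> strip h" "w = F u" using \<open>W \<subseteq> D\<close> by (auto simp: D_def)
      have "Re u \<noteq> s"
      proof
        assume "Re u = s"
        then have "u = Complex s (Im u)" by (simp add: complex_eq_iff)
        moreover have "\<bar>Im u\<bar> < h" using u by (simp add: strip_def)
        ultimately have "w \<in> K" using G(2)[of "Im u"] u unfolding K_def by (auto simp: image_iff abs_less_iff intro!: bexI[of _ "Im u"])
        then show False using W w by blast
      qed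
      then show "w \<in> left \<union> right" using u by (auto simp: left_def right_def neq_iff)
    qed
    then show False using connectedD[OF W(1) op] disj W a b by blast
  qed
  then show ?thesis unfolding left_def right_def by blast
qed

section \<open>The modulus of continuity of the conformal map\<close>

text \<open>This is \<open>- tanh (u / 2)\<close>: \<open>exp\<close> maps the strip of height pi
  onto the right half-plane, and the Cayley transform, its own inverse, maps that onto the disc.
  Vertical lines become circular arcs around 1 on which the ratio of the distances to 1 and -1 is
  constant.\<close>

definition disc_of_strip :: "complex \<Rightarrow> complex" where
  "disc_of_strip u = (1 - exp u) / (1 + exp u)"

lemma Re_exp_pos:
  assumes "u \<in> strip (pi / 2)"
  shows "Re (exp u) > 0"
proof -
  have "\<bar>Im u\<bar> < pi / 2" using assms by (simp add: strip_def)
  then have "cos (Im u) > 0" by (intro cos_gt_zero_pi) linarith+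
  then show ?thesis by (simp add: Re_exp)
qed

lemma norm_diff_less_norm_add_iff: "norm (1 - v) < norm (1 + v) \<longleftrightarrow> Re v > 0" for v :: complex
proof -
  have "norm (1 - v) < norm (1 + v) \<longleftrightarrow> (norm (1 - v))\<^sup>2 < (norm (1 + v))\<^sup>2"
    unfolding not_le[symmetric] by simp
  also have "\<dots> \<longleftrightarrow> Re v > 0" unfolding cmod_power2 by (simp add: power2_eq_square algebra_simps)
  finally show ?thesis .
qed

lemma one_plus_exp_nonzero: "u \<in> strip (pi / 2) \<Longrightarrow> 1 + exp u \<noteq> 0"
  using Re_exp_pos[of u] by (auto simp: complex_eq_iff)

lemma disc_of_strip_in_ball: "u \<in> strip (pi / 2) \<Longrightarrow> disc_of_strip u \<in> ball 0 1"
  using norm_diff_less_norm_add_iff[of "exp u"] Re_exp_pos[of u] one_plus_exp_nonzero[of u]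
  by (simp add: disc_of_strip_def norm_divide)

lemma holomorphic_disc_of_strip: "disc_of_strip holomorphic_on strip (pi / 2)"
  unfolding disc_of_strip_def by (intro holomorphic_intros one_plus_exp_nonzero)

lemma inj_on_disc_of_strip: "inj_on disc_of_strip (strip (pi / 2))"
proof (rule inj_onI)
  fix u v assume uv: "u \<in> strip (pi / 2)" "v \<in> strip (pi / 2)" "disc_of_strip u = disc_of_strip v"
  then have "exp u = exp v"
    using one_plus_exp_nonzero[of u] one_plus_exp_nonzero[of v]
    by (simp add: disc_of_strip_def frac_eq_eq) (simp add: algebra_simps)
  then have "Ln (exp u) = Ln (exp v)" by simp
  moreover have "\<bar>Im u\<bar> < pi" "\<bar>Im v\<bar> < pi" using uv pi_gt_zero unfolding strip_def mem_Collect_eq by linarith+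
  then have "Ln (exp u) = u" "Ln (exp v) = v" by (auto intro!: Ln_exp simp: abs_less_iff)
  ultimately show "u = v" by simp
qed

text \<open>The preimage is \<open>Ln\<close> of the same Cayley transform. The formula for
  \<open>exp (Re u)\<close> decides on which side of a vertical line the point x lies.\<close>

lemma ex_disc_of_strip:
  assumes "x \<in> ball 0 1"
  shows "\<exists>u\<in>strip (pi / 2). disc_of_strip u = x \<and> exp (Re u) = norm (1 - x) / norm (1 + x)"
proof -
  define v where "v = (1 - x) / (1 + x)"
  have x: "norm x < 1" using assms by simp
  have ne: "1 + x \<noteq> 0" using x by (metis add.inverse_unique norm_minus_cancel norm_one less_irrefl)
  have "1 - x \<noteq> 0" using x by auto
  then have v0: "v \<noteq> 0" using ne by (simp add: v_def)
  have v1: "1 + v = 2 / (1 + x)" "1 - v = 2 * x / (1 + x)" using ne by (simp_all add: v_def field_simps)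
  then have "norm (1 - v) < norm (1 + v)" using x ne by (simp add: norm_divide norm_mult divide_strict_right_mono)
  then have "Re v > 0" by (simp add: norm_diff_less_norm_add_iff)
  then have "Ln v \<in> strip (pi / 2)" using Re_Ln_pos_lt[OF v0] by (simp add: strip_def)
  moreover have "disc_of_strip (Ln v) = x"
    using v0 v1 ne by (simp add: disc_of_strip_def)
  moreover have "exp (Re (Ln v)) = norm (1 - x) / norm (1 + x)"
    using v0 by (simp add: v_def norm_divide)
  ultimately show ?thesis by blast
qed

lemma modulus_near_boundary:
  assumes D: "bounded D" and bcf: "boundary_connectivity_function D g" and conf: "conformal_map_onto \<phi> D"
  shows "\<exists>N k0. \<forall>k\<ge>k0. \<forall>\<zeta>\<in>sphere 0 1. \<forall>z\<in>ball 0 1. \<forall>w\<in>ball 0 1.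
    dist z \<zeta> < 1 / 4 ^ (N * 4 ^ (g k + k) + 1) \<longrightarrow> dist w \<zeta> < 1 / 4 ^ (N * 4 ^ (g k + k) + 1) \<longrightarrow>
    dist (\<phi> z) (\<phi> w) \<le> 2 / 2 ^ k"
proof -
  have hol: "\<phi> holomorphic_on ball 0 1" and inj: "inj_on \<phi> (ball 0 1)" and im: "\<phi> ` ball 0 1 = D"
    using conf analytic_imp_holomorphic by (auto simp: conformal_map_onto_def)
  obtain B where B: "D \<subseteq> cball 0 B" "B > 0"
    using D bounded_subset_ballD[of D 0] ball_subset_cball by blast
  \<comment> \<open>The strip has height pi and the energy is at most (2 B)^2 / L, so L = N /
    \<delta>^2 meets the condition of \<open>increment_le_uniform\<close>.\<close>
  obtain N :: nat where N: "pi * (2 * B)\<^sup>2 \<le> real N" using real_arch_simple by blast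
  moreover have "pi * (2 * B)\<^sup>2 > 0" using B by simp
  ultimately have "N > 0" by (cases N) auto
  \<comment> \<open>For k \<ge> k0 no disc of radius 2^-k contains both values, which will exclude
    the side of the crosscut away from \<zeta>.\<close>
  have "\<phi> 0 \<noteq> \<phi> (1 / 4)" using inj by (auto dest!: inj_onD)
  then have "dist (\<phi> 0) (\<phi> (1 / 4)) / 2 > 0" by simp
  then obtain k0 where "(1 / 2) ^ k0 < dist (\<phi> 0) (\<phi> (1 / 4)) / 2"
    using real_arch_pow_inv[of "dist (\<phi> 0) (\<phi> (1 / 4)) / 2" "1 / 2"] by auto
  then have k0: "2 / 2 ^ k0 < dist (\<phi> 0) (\<phi> (1 / 4))" by (simp add: power_divide)
  have "dist (\<phi> z) (\<phi> w) \<le> 2 / 2 ^ k"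
    if "k \<ge> k0" and \<zeta>: "\<zeta> \<in> sphere 0 1" and zw: "z \<in> ball 0 1" "w \<in> ball 0 1"
      "dist z \<zeta> < 1 / 4 ^ (N * 4 ^ (g k + k) + 1)" "dist w \<zeta> < 1 / 4 ^ (N * 4 ^ (g k + k) + 1)" for k \<zeta> z w
  proof -
    \<comment> \<open>The summand \<open>k\<close> in the exponent ensures \<delta> \<le> \<rho>, so
      that the crosscut itself fits into the disc.\<close>
    define \<delta> :: real where "\<delta> = 1 / 2 ^ (g k + k)"
    define \<rho> :: real where "\<rho> = 1 / 2 ^ k"
    define L where "L = real N * 4 ^ (g k + k)"
    define E where "E = (2 * B)\<^sup>2 / L"
    define F where "F = (\<lambda>u. \<phi> (\<zeta> * disc_of_strip u))"
    have \<zeta>1: "norm \<zeta> = 1" "\<zeta> \<noteq> 0" using \<zeta> by auto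
    have rot: "\<zeta> * x \<in> ball 0 1 \<longleftrightarrow> x \<in> ball 0 1" for x by (simp add: norm_mult \<zeta>1)
    have \<delta>: "\<delta> > 0" "\<delta> \<le> 1 / 2 ^ g k" "\<delta> \<le> \<rho>"
      unfolding \<delta>_def \<rho>_def by (auto intro!: divide_left_mono power_increasing)
    have "L > 0" using \<open>N > 0\<close> by (simp add: L_def)
    have F: "F holomorphic_on strip (pi / 2)"
    proof -
      have "\<phi> \<circ> (\<lambda>u. \<zeta> * disc_of_strip u) holomorphic_on strip (pi / 2)"
        by (intro holomorphic_on_compose_gen[OF _ hol] holomorphic_intros holomorphic_disc_of_strip)
           (use disc_of_strip_in_ball rot in blast)
      then show ?thesis by (simp add: F_def o_def)
    qed
    have Finj: "inj_on F (strip (pi / 2))"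
    proof (rule inj_onI)
      fix u v assume uv: "u \<in> strip (pi / 2)" "v \<in> strip (pi / 2)" "F u = F v"
      then have "\<zeta> * disc_of_strip u = \<zeta> * disc_of_strip v"
        unfolding F_def using inj_onD[OF inj] rot disc_of_strip_in_ball by blast
      then show "u = v" using uv inj_onD[OF inj_on_disc_of_strip] \<zeta>1 by simp
    qed
    have pre: "\<exists>u\<in>strip (pi / 2). F u = \<phi> x \<and> exp (Re u) = norm (\<zeta> - x) / norm (\<zeta> + x)"
      if "x \<in> ball 0 1" for x
    proof -
      have "x / \<zeta> \<in> ball 0 1" using that \<zeta>1 by (simp add: norm_divide)
      then obtain u where u: "u \<in> strip (pi / 2)" "disc_of_strip u = x / \<zeta>"
        "exp (Re u) = norm (1 - x / \<zeta>) / norm (1 + x / \<zeta>)"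
        using ex_disc_of_strip by blast
      have "1 - x / \<zeta> = (\<zeta> - x) / \<zeta>" "1 + x / \<zeta> = (\<zeta> + x) / \<zeta>" using \<zeta>1 by (simp_all add: field_simps)
      then have "exp (Re u) = norm (\<zeta> - x) / norm (\<zeta> + x)" using u(3) \<zeta>1 by (simp add: norm_divide)
      moreover have "F u = \<phi> x" using u(2) \<zeta>1 by (simp add: F_def)
      ultimately show ?thesis using u(1) by blast
    qed
    have imF: "F ` strip (pi / 2) = D"
    proof
      show "F ` strip (pi / 2) \<subseteq> D"
        unfolding im[symmetric] F_def using disc_of_strip_in_ball rot by blast
      show "D \<subseteq> F ` strip (pi / 2)" unfolding im[symmetric] by (rule image_subsetI) (metis pre image_eqI)
    qed
    \<comment> \<open>The interval has length L. Its right end leaves the points with |x| \<le> 1/4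
      on the right of the line, as there exp (Re u) \<ge> 3/5 > exp (-1); its left end puts all
      points within exp (-L - 1) of \<zeta> on the left.\<close>
    obtain s where s: "s \<in> {-L-1..-1}"
      and "\<And>r. r < pi / 2 \<Longrightarrow> integral {-r..r} (\<lambda>y. (norm (deriv F (Complex s y)))\<^sup>2) \<le> (2 * B)\<^sup>2 / (-1 - (-L-1))"
      using ex_line_small_energy[OF F Finj, of B "-L-1" "-1"] B \<open>L > 0\<close> by (auto simp: imF)
    then have energy: "\<And>r. r < pi / 2 \<Longrightarrow> integral {-r..r} (\<lambda>y. (norm (deriv F (Complex s y)))\<^sup>2) \<le> E"
      by (simp add: E_def)
    have "E \<ge> 0" using \<open>L > 0\<close> by (simp add: E_def)
    have E\<delta>: "2 * (pi / 2) * E \<le> \<delta>\<^sup>2"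
    proof -
      have "2 * (pi / 2) * E = (pi * (2 * B)\<^sup>2) / L" by (simp add: E_def)
      also have "\<dots> \<le> real N / L" using N \<open>L > 0\<close> by (intro divide_right_mono) auto
      also have "\<dots> = 1 / (2\<^sup>2) ^ (g k + k)" using \<open>N > 0\<close> by (simp add: L_def)
      also have "\<dots> = \<delta>\<^sup>2"
        unfolding \<delta>_def power_divide power_one by (simp only: power_mult[symmetric] mult.commute)
      finally show ?thesis .
    qed
    have "\<exists>p. F ` {u \<in> strip (pi / 2). Re u < s} \<subseteq> cball p \<rho> \<or> F ` {u \<in> strip (pi / 2). s < Re u} \<subseteq> cball p \<rho>"
    proof (rule crosscut_side_in_cball[OF F Finj _ uniformly_continuous_on_line[OF F energy \<open>E \<ge> 0\<close>] _ \<delta>(3)])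
      show "dist (F (Complex s y)) (F (Complex s y')) \<le> \<delta>" if "\<bar>y\<bar> < pi / 2" "\<bar>y'\<bar> < pi / 2" for y y'
        by (rule increment_le_uniform[OF F energy that \<delta>(1) E\<delta>])
      show "\<exists>A. compact A \<and> connected A \<and> p \<in> A \<and> q \<in> A \<and> A \<subseteq> frontier (F ` strip (pi / 2)) \<and> A \<subseteq> cball p \<rho>"
        if pq: "p \<in> frontier (F ` strip (pi / 2))" "q \<in> frontier (F ` strip (pi / 2))" "dist p q \<le> \<delta>" for p q
      \<comment> \<open>The connectivity function speaks only of distinct points, but the ends of a
        crosscut may coincide.\<close>
      proof (cases "p = q")
        case True
        then show ?thesis using pq \<delta> by (intro exI[of _ "{p}"]) (simp add: \<rho>_def)
      next
        case False
        moreover have "dist p q \<le> 1 / 2 ^ g k" using pq(3) \<delta>(2) by linarith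
        ultimately obtain \<gamma> where \<gamma>: "arc \<gamma>" "pathstart \<gamma> = p" "pathfinish \<gamma> = q"
          "path_image \<gamma> \<subseteq> frontier D" "diameter (path_image \<gamma>) < \<rho>"
          using bcf pq imF unfolding boundary_connectivity_function_def \<rho>_def by metis
        have "p \<in> path_image \<gamma>" "q \<in> path_image \<gamma>" using \<gamma> by blast+
        moreover have "path_image \<gamma> \<subseteq> cball p \<rho>"
        proof
          fix x assume "x \<in> path_image \<gamma>"
          then have "dist p x \<le> diameter (path_image \<gamma>)"
            using \<gamma>(1) \<open>p \<in> path_image \<gamma>\<close> by (intro diameter_bounded_bound bounded_arc_image)
          then show "x \<in> cball p \<rho>" using \<gamma>(5) by simp
        qed
        ultimately show ?thesis
          using \<gamma> imF by (intro exI[of _ "path_image \<gamma>"]) (auto simp: compact_arc_image connected_arc_image)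
      qed
    qed simp
    then obtain p where p: "F ` {u \<in> strip (pi / 2). Re u < s} \<subseteq> cball p \<rho> \<or>
        F ` {u \<in> strip (pi / 2). s < Re u} \<subseteq> cball p \<rho>" by blast
    have e_bounds: "exp (-1::real) \<le> 1 / 2" "exp (1::real) \<le> 4"
      using exp_ge_add_one_self[of 1] exp_le by (auto simp: exp_minus field_simps)
    have "\<not> F ` {u \<in> strip (pi / 2). s < Re u} \<subseteq> cball p \<rho>"
    proof
      assume sub: "F ` {u \<in> strip (pi / 2). s < Re u} \<subseteq> cball p \<rho>"
      have mem: "\<phi> x \<in> cball p \<rho>" if x: "norm x \<le> 1 / 4" for x
      proof -
        have "x \<in> ball 0 1" using x by simp
        then obtain u where u: "u \<in> strip (pi / 2)" "F u = \<phi> x" "exp (Re u) = norm (\<zeta> - x) / norm (\<zeta> + x)"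
          using pre by blast
        have "norm (\<zeta> - x) \<ge> 3 / 4" "norm (\<zeta> + x) \<le> 5 / 4"
          using norm_triangle_ineq2[of \<zeta> x] norm_triangle_ineq[of \<zeta> x] x \<zeta>1 by linarith+
        moreover have "norm (\<zeta> + x) > 0"
          using norm_triangle_ineq2[of \<zeta> "- x"] x \<zeta>1 unfolding norm_minus_cancel diff_minus_eq_add by linarith
        ultimately have "exp (Re u) > 1 / 2" unfolding u(3) by (simp add: field_simps)
        then have "exp (-1) < exp (Re u)" using e_bounds by linarith
        then have "s < Re u" using s by simp
        then show ?thesis using sub u by auto
      qed
      have "dist (\<phi> 0) (\<phi> (1 / 4)) \<le> 2 * \<rho>"
        using mem[of 0] mem[of "1 / 4"] dist_triangle[of "\<phi> 0" "\<phi> (1 / 4)" p]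
        by (simp add: dist_commute norm_divide)
      also have "\<dots> \<le> 2 / 2 ^ k0" using \<open>k \<ge> k0\<close> by (simp add: \<rho>_def divide_left_mono power_increasing)
      finally show False using k0 by simp
    qed
    then have left: "F ` {u \<in> strip (pi / 2). Re u < s} \<subseteq> cball p \<rho>" using p by blast
    have mem: "\<phi> x \<in> cball p \<rho>" if x: "x \<in> ball 0 1" "dist x \<zeta> < 1 / 4 ^ (N * 4 ^ (g k + k) + 1)" for x
    proof -
      obtain u where u: "u \<in> strip (pi / 2)" "F u = \<phi> x" "exp (Re u) = norm (\<zeta> - x) / norm (\<zeta> + x)"
        using pre x by blast
      \<comment> \<open>Replacing e by 4 makes the radius a power of 2 whose exponent is a recursive
        function of \<open>g k\<close> and \<open>k\<close>.\<close>
      have small: "(1::real) / 4 ^ (N * 4 ^ (g k + k) + 1) \<le> exp (-L - 1)"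
      proof -
        have "L + 1 = real (N * 4 ^ (g k + k) + 1) * 1" by (simp add: L_def)
        then have "exp (L + 1) = exp 1 ^ (N * 4 ^ (g k + k) + 1)" by (simp only: exp_of_nat_mult)
        also have "\<dots> \<le> 4 ^ (N * 4 ^ (g k + k) + 1)" using e_bounds by (intro power_mono) auto
        finally have "exp (L + 1) \<le> 4 ^ (N * 4 ^ (g k + k) + 1)" .
        moreover have "- L - 1 = - (L + 1)" by simp
        then have "exp (-L - 1) = 1 / exp (L + 1)" by (simp only: exp_minus inverse_eq_divide)
        ultimately show ?thesis by (simp add: divide_left_mono)
      qed
      have d: "norm (\<zeta> - x) < exp (-L - 1)" using x small by (simp add: dist_norm norm_minus_commute)
      moreover have "exp (-L - 1) \<le> 1" using \<open>L > 0\<close> by simp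
      moreover have "norm (\<zeta> + x) \<ge> 2 - norm (\<zeta> - x)"
        using norm_triangle_ineq[of "\<zeta> + x" "\<zeta> - x"] \<zeta>1 by (simp add: norm_mult)
      ultimately have "norm (\<zeta> + x) \<ge> 1" by linarith
      then have "norm (\<zeta> - x) / norm (\<zeta> + x) \<le> norm (\<zeta> - x) / 1"
        by (intro divide_left_mono) auto
      then have "exp (Re u) \<le> norm (\<zeta> - x)" unfolding u(3) by simp
      then have "exp (Re u) < exp (-L - 1)" using d by linarith
      then have "Re u < s" using s by simp
      then show ?thesis using left u by auto
    qed
    show ?thesis
      using mem[OF zw(1,3)] mem[OF zw(2,4)] dist_triangle[of "\<phi> z" "\<phi> w" p]
      by (simp add: dist_commute \<rho>_def)
  qed
  then show ?thesis by blast
qed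

section \<open>Points away from the circle and the global modulus\<close>

text \<open>The Schwarz lemma is applied to \<open>f\<close> recentred at \<open>z\<close> and
  rescaled; 2 B bounds the difference of two values of norm less than B.\<close>

lemma increment_le_Schwarz:
  assumes f: "f holomorphic_on ball z r" and bnd: "f ` ball z r \<subseteq> ball 0 B" and w: "w \<in> ball z r"
  shows "dist (f z) (f w) \<le> 2 * B * dist z w / r"
proof -
  have r: "r > 0" using w by (metis dist_pos_lt dual_order.strict_trans2 mem_ball zero_le_dist order_le_less_trans)
  have "f z \<in> ball 0 B" using bnd r by (meson centre_in_ball image_subset_iff)
  then have B: "norm (f z) < B" by simp
  then have "B > 0" by (rule le_less_trans[OF norm_ge_zero])
  note B = B this
  define h where "h = (\<lambda>t. (f (z + of_real r * t) - f z) / of_real (2 * B))"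
  have mem: "z + of_real r * t \<in> ball z r" if "norm t < 1" for t
    using that r by (simp add: dist_norm norm_mult)
  have "h holomorphic_on ball 0 1"
  proof -
    have "f \<circ> (\<lambda>t. z + of_real r * t) holomorphic_on ball 0 1"
      by (rule holomorphic_on_compose_gen[OF _ f]) (use mem in \<open>auto intro!: holomorphic_intros\<close>)
    then have "(\<lambda>t. f (z + of_real r * t)) holomorphic_on ball 0 1" by (simp add: o_def)
    then show ?thesis unfolding h_def using B by (intro holomorphic_intros) auto
  qed
  moreover have "h 0 = 0" by (simp add: h_def)
  moreover have "norm (h t) < 1" if "norm t < 1" for t
  proof -
    have "f (z + of_real r * t) \<in> ball 0 B" using bnd mem[OF that] by blast
    then have "norm (f (z + of_real r * t) - f z) < 2 * B"
      using norm_triangle_ineq4[of "f (z + of_real r * t)" "f z"] B by simp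
    then show ?thesis using B by (simp add: h_def norm_divide)
  qed
  moreover have "norm ((w - z) / of_real r) < 1"
    using w r by (simp add: norm_divide dist_norm norm_minus_commute)
  ultimately have "norm (h ((w - z) / of_real r)) \<le> norm ((w - z) / of_real r)"
    by (rule Schwarz_Lemma(1))
  moreover have "h ((w - z) / of_real r) = (f w - f z) / of_real (2 * B)" using r by (simp add: h_def)
  ultimately show ?thesis using r B
    by (simp add: norm_divide dist_norm norm_minus_commute field_simps)
qed

text \<open>The split is at distance \<eta>/2 from the circle. Closer to it, z and w are within
  \<eta> of the common boundary point \<open>sgn z\<close>; otherwise the disc of radius \<eta>/2
  about z lies in the unit disc.\<close>

lemma computable_modulus:
  assumes D: "bounded D" and g: "computable_nat g" and bcf: "boundary_connectivity_function D g"
    and conf: "conformal_map_onto \<phi> D"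
  shows "\<exists>m. computable_nat m \<and> (\<forall>k. \<forall>z\<in>ball 0 1. \<forall>w\<in>ball 0 1. dist z w < 1 / 2 ^ m k \<longrightarrow> dist (\<phi> z) (\<phi> w) \<le> 1 / 2 ^ k)"
proof -
  have hol: "\<phi> holomorphic_on ball 0 1" and im: "\<phi> ` ball 0 1 = D"
    using conf analytic_imp_holomorphic by (auto simp: conformal_map_onto_def)
  obtain B where B: "D \<subseteq> ball 0 B" "B > 0"
    using D bounded_subset_ballD[of D 0] by blast
  obtain N k0 where near: "\<And>k \<zeta> z w. \<lbrakk>k \<ge> k0; \<zeta> \<in> sphere 0 1; z \<in> ball 0 1; w \<in> ball 0 1;
      dist z \<zeta> < 1 / 4 ^ (N * 4 ^ (g k + k) + 1); dist w \<zeta> < 1 / 4 ^ (N * 4 ^ (g k + k) + 1)\<rbrakk>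
      \<Longrightarrow> dist (\<phi> z) (\<phi> w) \<le> 2 / 2 ^ k"
    using modulus_near_boundary[OF D bcf conf] by metis
  \<comment> \<open>4 B is the Schwarz constant for radius \<eta>/2; the successor gives 2 \<le>
    2^c, so that w is within \<eta>/2 of z.\<close>
  obtain c0 where "4 * B < 2 ^ c0" using real_arch_pow[of 2 "4 * B"] by auto
  moreover define c where "c = Suc c0"
  ultimately have c: "4 * B \<le> 2 ^ c" "(2::real) \<le> 2 ^ c" using B by (auto simp: power_Suc)
  define \<mu> where "\<mu> = (\<lambda>k. N * 4 ^ (g k + k) + 1)"
  \<comment> \<open>Doubling turns 4^\<mu> into a power of 2. The argument
    \<open>Suc (k + k0)\<close> passes the threshold \<open>k0\<close> and absorbs the factor 2 of
    the estimate near the circle; \<open>k + c\<close> serves the Schwarz estimate.\<close>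
  define m where "m = (\<lambda>k. 2 * \<mu> (Suc (k + k0)) + k + c)"
  have "rec_fun 1 (\<lambda>xs. m (xs ! 0))"
    unfolding m_def \<mu>_def
    by (intro rec_fun_add rec_fun_mult rec_fun_power rec_fun_const rec_fun_Suc rec_fun_nth
        rec_fun_comp1[of g, OF rec_fun_computable_nat[OF g]]) simp_all
  then have "computable_nat m"
    unfolding computable_nat_def rec_fun_def by (metis One_nat_def length_Cons list.size(3) nth_Cons_0)
  moreover have "dist (\<phi> z) (\<phi> w) \<le> 1 / 2 ^ k"
    if z: "z \<in> ball 0 1" and w: "w \<in> ball 0 1" and d: "dist z w < 1 / 2 ^ m k" for k z w
  proof -
    define \<eta> :: real where "\<eta> = 1 / 4 ^ \<mu> (Suc (k + k0))"
    have \<eta>: "\<eta> > 0" "\<eta> \<le> 1" by (simp_all add: \<eta>_def)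
    have mk: "1 / 2 ^ m k = \<eta> * (1 / 2 ^ k) * (1 / 2 ^ c)"
      by (simp add: m_def \<eta>_def power_add power_mult)
    have small: "1 / 2 ^ m k \<le> \<eta> / 2"
    proof -
      have "(1::real) / 2 ^ k * (1 / 2 ^ c) \<le> 1 * (1 / 2)"
        using c(2) by (intro mult_mono) (auto simp: divide_simps)
      then have "\<eta> * ((1::real) / 2 ^ k * (1 / 2 ^ c)) \<le> \<eta> * (1 * (1 / 2))"
        using \<eta>(1) by (intro mult_left_mono) auto
      then show ?thesis unfolding mk by (simp add: mult.assoc)
    qed
    show ?thesis
    proof (cases "1 - norm z < \<eta> / 2")
      case True
      then have "z \<noteq> 0" using \<eta> by auto
      have "dist z (sgn z) = 1 - norm z"
      proof -
        have "z - sgn z = - ((1 - norm z) *\<^sub>R sgn z)"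
          by (simp add: sgn_div_norm algebra_simps \<open>z \<noteq> 0\<close>)
        then show ?thesis using z \<open>z \<noteq> 0\<close> by (simp add: dist_norm norm_sgn)
      qed
      moreover have "dist z w < \<eta> / 2" using d small by linarith
      ultimately have "dist z (sgn z) < \<eta>" "dist w (sgn z) < \<eta>"
        using True dist_triangle[of w "sgn z" z] \<eta> by (simp_all add: dist_commute)
      then have "dist (\<phi> z) (\<phi> w) \<le> 2 / 2 ^ Suc (k + k0)"
        using \<open>z \<noteq> 0\<close> by (intro near[OF _ _ z w, of _ "sgn z"]) (auto simp: \<eta>_def \<mu>_def norm_sgn)
      also have "\<dots> = 1 / 2 ^ (k + k0)" by simp
      also have "\<dots> \<le> 1 / 2 ^ k" by (intro divide_left_mono power_increasing) auto
      finally show ?thesis .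
    next
      case False
      have wz: "w \<in> ball z (\<eta> / 2)" using d small by simp
      have sub: "ball z (\<eta> / 2) \<subseteq> ball 0 1"
      proof
        fix x assume "x \<in> ball z (\<eta> / 2)"
        then have "norm (z - x) < \<eta> / 2" by (simp add: dist_norm)
        then show "x \<in> ball 0 1" using False norm_triangle_ineq2[of x z] by (simp add: norm_minus_commute)
      qed
      have "dist (\<phi> z) (\<phi> w) \<le> 2 * B * dist z w / (\<eta> / 2)"
        by (rule increment_le_Schwarz[OF holomorphic_on_subset[OF hol sub] _ wz]) (use B im sub in blast)
      also have "\<dots> = 4 * B * dist z w / \<eta>" using \<eta> by simp
      also have "\<dots> \<le> 2 ^ c * (1 / 2 ^ m k) / \<eta>"
        using c(1) d \<eta> B by (intro divide_right_mono mult_mono) auto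
      also have "\<dots> = 1 / 2 ^ k" unfolding mk using \<eta> by simp
      finally show ?thesis .
    qed
  qed
  ultimately show ?thesis by blast
qed

theorem theorem3p9:
  fixes D :: "complex set" and \<phi> :: "complex \<Rightarrow> complex"
  assumes "open D" and "connected D" and "bounded D"
    and "\<exists>g. computable_nat g \<and> boundary_connectivity_function D g"
    and "conformal_map_onto \<phi> D" and "computable_on (ball 0 1) \<phi>"
  shows "\<exists>\<psi>. boundary_extension \<phi> \<psi> \<and> computable_on (cball 0 1) \<psi>"
proof -
  obtain m where m: "computable_nat m"
    and modulus: "\<And>k z w. \<lbrakk>z \<in> ball 0 1; w \<in> ball 0 1; dist z w < 1 / 2 ^ m k\<rbrakk> \<Longrightarrow> dist (\<phi> z) (\<phi> w) \<le> 1 / 2 ^ k"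
    using assms(4) computable_modulus[OF assms(3) _ _ assms(5)] by metis
  \<comment> \<open>The modulus itself supplies the extension, so the local connectivity of the
    boundary is never invoked separately.\<close>
  have "uniformly_continuous_on (ball 0 1) \<phi>"
    unfolding uniformly_continuous_on_def
  proof (intro allI impI)
    fix e :: real assume "e > 0"
    then obtain k where "(1 / 2) ^ k < e" using real_arch_pow_inv[of e "1 / 2"] by auto
    then have k: "1 / 2 ^ k < e" by (simp add: power_divide)
    show "\<exists>d>0. \<forall>x\<in>ball 0 1. \<forall>x'\<in>ball 0 1. dist x' x < d \<longrightarrow> dist (\<phi> x') (\<phi> x) < e"
    proof (intro exI[of _ "1 / 2 ^ m k"] conjI ballI impI)
      show "dist (\<phi> x') (\<phi> x) < e" if "x \<in> ball 0 1" "x' \<in> ball 0 1" "dist x' x < 1 / 2 ^ m k" for x x'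
        using modulus[OF that(2,1,3)] k by linarith
    qed simp
  qed
  then obtain \<psi> where "uniformly_continuous_on (closure (ball 0 1)) \<psi>" and eq: "\<And>x. x \<in> ball 0 1 \<Longrightarrow> \<phi> x = \<psi> x"
    by (metis uniformly_continuous_on_extension_on_closure)
  then have cont: "continuous_on (cball 0 1) \<psi>" by (simp add: uniformly_continuous_imp_continuous)
  have "dist (\<psi> z) (\<phi> w) \<le> 1 / 2 ^ k"
    if "z \<in> cball 0 1" "w \<in> ball 0 1" "dist z w < 1 / 2 ^ m k" for k z w
  proof -
    \<comment> \<open>The strict bound on \<open>dist z w\<close> is an open condition and the
      estimate a closed one, so the modulus passes to limits from the open disc.\<close>
    let ?X = "ball w (1 / 2 ^ m k) \<inter> ball 0 1"
    have "\<psi> ` closure ?X \<subseteq> cball (\<phi> w) (1 / 2 ^ k)"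
    proof (rule image_closure_subset)
      have "closure ?X \<subseteq> closure (ball 0 1)" by (rule closure_mono) simp
      then show "continuous_on (closure ?X) \<psi>" using cont by (auto intro: continuous_on_subset)
      show "\<psi> ` ?X \<subseteq> cball (\<phi> w) (1 / 2 ^ k)"
        using modulus[OF that(2)] eq by (auto simp: image_subset_iff)
    qed simp
    moreover have "z \<in> closure ?X"
      using open_Int_closure_subset[of "ball w (1 / 2 ^ m k)" "ball 0 1"] that
      by (auto simp: dist_commute)
    ultimately have "\<psi> z \<in> cball (\<phi> w) (1 / 2 ^ k)" by blast
    then show ?thesis by (simp add: dist_commute)
  qed
  then have "computable_on (cball 0 1) \<psi>"
    by (rule computable_on_cball_if_modulus[OF assms(6) m])
  moreover have "boundary_extension \<phi> \<psi>"
    using cont eq by (simp add: boundary_extension_def)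
  ultimately show ?thesis by blast
qed

end
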